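(* Let $T$ be a complete simple theory, let $(p_w(x_w))_{w\in W}$ be an amalgamation system over a set of parameters $A$, and let $B\supseteq A$ be such that every $p_w(x_w)$ has a unique nonforking extension $q_w(x_w)$ to $B$. Then $(q_w(x_w))_{w\in W}$ is an amalgamation system over $B$.
   Context: Independence is nonforking independence. For finite $W\subseteq\mathfrak{P}(\mathbb{N})$ closed under subsets, a $W$-amalgamation system over $C$ is a family $(p_w(x_w))_{w\in W}$ of complete types over $C$ such that: (1) for distinct variables $y,z$ in $x_w$, $p_w\vdash y\ne z$; (2) $x_v\cap x_w=x_{v\cap w}$ for all $v,w\in W$ and $p_w\upharpoonright x_v=p_v$ whenever $v\subseteq w$; (3) for any realization $b_w$ of $p_w$, with $b_i=b_w\upharpoonright x_{\{i\}}$ for $i\in w$, the family $(b_i)_{i\in w}$ is independent over $C$ and $b_w$ is algebraic over $C\cup\{b_i:i\in w\}$. *)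

theory Defs
  imports Main
begin

unbundle cardinal_syntax

section \<open>First-order logic\<close>

text \<open>
  Free variables and parameters are ``atoms'', taken from an arbitrary type; bound variables are
  de Bruijn indices. An \<open>L(C)\<close>-formula in the variables \<open>x\<close> is a formula over the atom type
  \<open>'v + 'm\<close> whose atoms are \<open>Inl v\<close> with \<open>v \<in> x\<close> (variables) or \<open>Inr c\<close> with \<open>c \<in> C\<close>
  (names of parameters). An \<open>L\<close>-formula \<open>\<phi>(x, y)\<close> with \<open>y = (y\<^sub>0, \<dots>, y\<^sub>n\<^sub>-\<^sub>1)\<close> is represented over
  \<open>'v + nat\<close> in the same way.
\<close>

datatype (dead 'f, atms_tm: 'a) tm =
    Bd nat
  | At 'a
  | Fn 'f "('f, 'a) tm list"
  for map: map_tm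

datatype (dead 'f, dead 'r, atms_fm: 'a) fm =
    Eq "('f, 'a) tm" "('f, 'a) tm"
  | Rl 'r "('f, 'a) tm list"
  | Neg "('f, 'r, 'a) fm"
  | Conj "('f, 'r, 'a) fm" "('f, 'r, 'a) fm"
  | Ex "('f, 'r, 'a) fm"
  for map: map_fm

record ('f, 'r) lang =
  funs :: "'f set"
  rels :: "'r set"
  far :: "'f \<Rightarrow> nat"
  rar :: "'r \<Rightarrow> nat"

record ('f, 'r, 'm) struct =
  fint :: "'f \<Rightarrow> 'm list \<Rightarrow> 'm"
  rint :: "'r \<Rightarrow> 'm list \<Rightarrow> bool"

text \<open>The number \<open>k\<close> bounds the de Bruijn indices that may occur unbound.\<close>

primrec wft :: "('f, 'r) lang \<Rightarrow> nat \<Rightarrow> ('f, 'a) tm \<Rightarrow> bool" where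
  "wft L k (Bd i) \<longleftrightarrow> i < k"
| "wft L k (At a) \<longleftrightarrow> True"
| "wft L k (Fn f ts) \<longleftrightarrow> f \<in> funs L \<and> length ts = far L f \<and> list_all (wft L k) ts"

primrec wff :: "('f, 'r) lang \<Rightarrow> nat \<Rightarrow> ('f, 'r, 'a) fm \<Rightarrow> bool" where
  "wff L k (Eq s t) \<longleftrightarrow> wft L k s \<and> wft L k t"
| "wff L k (Rl r ts) \<longleftrightarrow> r \<in> rels L \<and> length ts = rar L r \<and> list_all (wft L k) ts"
| "wff L k (Neg \<phi>) \<longleftrightarrow> wff L k \<phi>"
| "wff L k (Conj \<phi> \<psi>) \<longleftrightarrow> wff L k \<phi> \<and> wff L k \<psi>"
| "wff L k (Ex \<phi>) \<longleftrightarrow> wff L (Suc k) \<phi>"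

primrec val :: "('f, 'r, 'm) struct \<Rightarrow> ('a \<Rightarrow> 'm) \<Rightarrow> 'm list \<Rightarrow> ('f, 'a) tm \<Rightarrow> 'm" where
  "val M e vs (Bd i) = vs ! i"
| "val M e vs (At a) = e a"
| "val M e vs (Fn f ts) = fint M f (map (val M e vs) ts)"

primrec sat :: "('f, 'r, 'm) struct \<Rightarrow> ('a \<Rightarrow> 'm) \<Rightarrow> 'm list \<Rightarrow> ('f, 'r, 'a) fm \<Rightarrow> bool" where
  "sat M e vs (Eq s t) \<longleftrightarrow> val M e vs s = val M e vs t"
| "sat M e vs (Rl r ts) \<longleftrightarrow> rint M r (map (val M e vs) ts)"
| "sat M e vs (Neg \<phi>) \<longleftrightarrow> \<not> sat M e vs \<phi>"
| "sat M e vs (Conj \<phi> \<psi>) \<longleftrightarrow> sat M e vs \<phi> \<and> sat M e vs \<psi>"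
| "sat M e vs (Ex \<phi>) \<longleftrightarrow> (\<exists>a. sat M e (a # vs) \<phi>)"

definition fmls :: "('f, 'r) lang \<Rightarrow> 'v set \<Rightarrow> 'c set \<Rightarrow> ('f, 'r, 'v + 'c) fm set" where
  "fmls L x C = {\<phi>. wff L 0 \<phi> \<and> atms_fm \<phi> \<subseteq> x <+> C}"

definition inst :: "(nat \<Rightarrow> 'm) \<Rightarrow> ('f, 'r, 'v + nat) fm \<Rightarrow> ('f, 'r, 'v + 'm) fm" where
  "inst b \<phi> = map_fm (map_sum id b) \<phi>"

definition holds :: "('f, 'r, 'm) struct \<Rightarrow> ('v \<Rightarrow> 'm) \<Rightarrow> ('f, 'r, 'v + 'm) fm \<Rightarrow> bool" where
  "holds M e \<phi> \<longleftrightarrow> sat M (case_sum e id) [] \<phi>"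

definition sentences :: "('f, 'r) lang \<Rightarrow> ('f, 'r, nat) fm set" where
  "sentences L = {\<phi>. wff L 0 \<phi> \<and> atms_fm \<phi> = {}}"

definition models :: "('f, 'r, 'm) struct \<Rightarrow> ('f, 'r, nat) fm set \<Rightarrow> bool" where
  "models M T \<longleftrightarrow> (\<forall>\<phi>\<in>T. \<forall>e. sat M e [] \<phi>)"

text \<open>Theories are deductively closed. Consistency is not part of this definition: it is only used
  for theories which are given together with a model.\<close>

definition complete_theory :: "('f, 'r) lang \<Rightarrow> ('f, 'r, nat) fm set \<Rightarrow> bool" where
  "complete_theory L T \<longleftrightarrow> T \<subseteq> sentences L \<and> (\<forall>\<phi>\<in>sentences L. \<phi> \<in> T \<or> Neg \<phi> \<in> T)"

section \<open>Types\<close>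

definition consistent :: "('f, 'r, 'm) struct \<Rightarrow> ('f, 'r, 'v + 'm) fm set \<Rightarrow> bool" where
  "consistent M \<Gamma> \<longleftrightarrow> (\<forall>\<Gamma>\<^sub>0\<subseteq>\<Gamma>. finite \<Gamma>\<^sub>0 \<longrightarrow> (\<exists>e. \<forall>\<phi>\<in>\<Gamma>\<^sub>0. holds M e \<phi>))"

definition realizes :: "('f, 'r, 'm) struct \<Rightarrow> ('v \<Rightarrow> 'm) \<Rightarrow> ('f, 'r, 'v + 'm) fm set \<Rightarrow> bool" where
  "realizes M b \<Gamma> \<longleftrightarrow> (\<forall>\<phi>\<in>\<Gamma>. holds M b \<phi>)"

text \<open>\<open>\<Gamma> \<turnstile> \<Or>\<Psi>\<close>, modulo the elementary diagram of \<open>M\<close>; the disjunction is over a finite set \<open>\<Psi>\<close>.\<close>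

definition proves_disj ::
  "('f, 'r, 'm) struct \<Rightarrow> ('f, 'r, 'v + 'm) fm set \<Rightarrow> ('f, 'r, 'v + 'm) fm set \<Rightarrow> bool" where
  "proves_disj M \<Gamma> \<Psi> \<longleftrightarrow>
     (\<exists>\<Gamma>\<^sub>0\<subseteq>\<Gamma>. finite \<Gamma>\<^sub>0 \<and> (\<forall>e. (\<forall>\<phi>\<in>\<Gamma>\<^sub>0. holds M e \<phi>) \<longrightarrow> (\<exists>\<psi>\<in>\<Psi>. holds M e \<psi>)))"

definition complete_type ::
  "('f, 'r) lang \<Rightarrow> ('f, 'r, 'm) struct \<Rightarrow> 'm set \<Rightarrow> 'v set \<Rightarrow> ('f, 'r, 'v + 'm) fm set \<Rightarrow> bool" where
  "complete_type L M C x p \<longleftrightarrow>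
     p \<subseteq> fmls L x C \<and> consistent M p \<and> (\<forall>\<phi>\<in>fmls L x C. \<phi> \<in> p \<or> Neg \<phi> \<in> p)"

text \<open>\<open>tp L M C x b\<close> is the type over \<open>C\<close> of the tuple \<open>b\<restriction>x\<close>.\<close>

definition tp ::
  "('f, 'r) lang \<Rightarrow> ('f, 'r, 'm) struct \<Rightarrow> 'm set \<Rightarrow> 'v set \<Rightarrow> ('v \<Rightarrow> 'm) \<Rightarrow> ('f, 'r, 'v + 'm) fm set"
  where "tp L M C x b = {\<phi> \<in> fmls L x C. holds M b \<phi>}"

definition acl :: "('f, 'r) lang \<Rightarrow> ('f, 'r, 'm) struct \<Rightarrow> 'm set \<Rightarrow> 'm set" where
  "acl L M C = {a. \<exists>\<phi>\<in>fmls L (UNIV :: unit set) C.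
     holds M (\<lambda>_. a) \<phi> \<and> finite {a'. holds M (\<lambda>_. a') \<phi>}}"

section \<open>Monster models\<close>

definition small :: "'k rel \<Rightarrow> 'a set \<Rightarrow> bool" where
  "small \<kappa> X \<longleftrightarrow> |X| <o \<kappa>"

definition saturated :: "('f, 'r) lang \<Rightarrow> 'k rel \<Rightarrow> ('f, 'r, 'm) struct \<Rightarrow> bool" where
  "saturated L \<kappa> M \<longleftrightarrow>
     (\<forall>C p. small \<kappa> C \<longrightarrow> complete_type L M C (UNIV :: unit set) p \<longrightarrow> (\<exists>b. realizes M b p))"

definition automorphism :: "('f, 'r) lang \<Rightarrow> ('f, 'r, 'm) struct \<Rightarrow> ('m \<Rightarrow> 'm) \<Rightarrow> bool" where
  "automorphism L M g \<longleftrightarrow> bij g \<and>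
     (\<forall>f\<in>funs L. \<forall>as. length as = far L f \<longrightarrow> g (fint M f as) = fint M f (map g as)) \<and>
     (\<forall>r\<in>rels L. \<forall>as. length as = rar L r \<longrightarrow> (rint M r (map g as) \<longleftrightarrow> rint M r as))"

text \<open>A map \<open>g\<close> is elementary on \<open>D\<close> iff the families \<open>(d)\<^sub>d\<^sub>\<in>\<^sub>D\<close> and \<open>(g d)\<^sub>d\<^sub>\<in>\<^sub>D\<close>, with the elements
  of \<open>D\<close> serving as variables, have the same type over the empty set.\<close>

definition strongly_homogeneous :: "('f, 'r) lang \<Rightarrow> 'k rel \<Rightarrow> ('f, 'r, 'm) struct \<Rightarrow> bool" where
  "strongly_homogeneous L \<kappa> M \<longleftrightarrow>
     (\<forall>D g. small \<kappa> D \<longrightarrow> tp L M {} D id = tp L M {} D g \<longrightarrow>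
        (\<exists>h. automorphism L M h \<and> (\<forall>d\<in>D. h d = g d)))"

definition monster_model ::
  "('f, 'r) lang \<Rightarrow> ('f, 'r, nat) fm set \<Rightarrow> 'k rel \<Rightarrow> ('f, 'r, 'm) struct \<Rightarrow> bool" where
  "monster_model L T \<kappa> M \<longleftrightarrow>
     Card_order \<kappa> \<and> small \<kappa> (funs L <+> rels L <+> (UNIV :: nat set)) \<and>
     models M T \<and> saturated L \<kappa> M \<and> strongly_homogeneous L \<kappa> M"

section \<open>Forking and simplicity\<close>

definition k_inconsistent ::
  "('f, 'r, 'm) struct \<Rightarrow> nat \<Rightarrow> (nat \<Rightarrow> ('f, 'r, 'v + 'm) fm) \<Rightarrow> bool" where
  "k_inconsistent M k \<Phi> \<longleftrightarrow> (\<forall>I. finite I \<and> card I = k \<longrightarrow> \<not> consistent M (\<Phi> ` I))"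

definition divides ::
  "('f, 'r) lang \<Rightarrow> ('f, 'r, 'm) struct \<Rightarrow> 'm set \<Rightarrow> 'v set \<Rightarrow> ('f, 'r, 'v + 'm) fm \<Rightarrow> bool" where
  "divides L M A x \<psi> \<longleftrightarrow>
     (\<exists>n. \<exists>\<phi>\<in>fmls L x {..<n}. \<exists>b. \<psi> = inst b \<phi> \<and>
        (\<exists>k c. (\<forall>i::nat. tp L M A {..<n} (c i) = tp L M A {..<n} b) \<and>
               k_inconsistent M k (\<lambda>i. inst (c i) \<phi>)))"

definition forks ::
  "('f, 'r) lang \<Rightarrow> ('f, 'r, 'm) struct \<Rightarrow> 'm set \<Rightarrow> 'v set \<Rightarrow> ('f, 'r, 'v + 'm) fm set \<Rightarrow> bool" where
  "forks L M A x \<pi> \<longleftrightarrow>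
     (\<exists>\<Psi>. finite \<Psi> \<and> (\<forall>\<psi>\<in>\<Psi>. divides L M A x \<psi>) \<and> proves_disj M \<pi> \<Psi>)"

definition nonforking_extension ::
  "('f, 'r) lang \<Rightarrow> ('f, 'r, 'm) struct \<Rightarrow> 'm set \<Rightarrow> 'm set \<Rightarrow> 'v set \<Rightarrow>
   ('f, 'r, 'v + 'm) fm set \<Rightarrow> ('f, 'r, 'v + 'm) fm set \<Rightarrow> bool" where
  "nonforking_extension L M A B x p q \<longleftrightarrow>
     complete_type L M B x q \<and> p \<subseteq> q \<and> \<not> forks L M A x q"

text \<open>Independence over \<open>C\<close> of the family of tuples \<open>(b\<restriction>X i)\<^sub>i\<^sub>\<in>\<^sub>w\<close>.\<close>

definition independent ::
  "('f, 'r) lang \<Rightarrow> ('f, 'r, 'm) struct \<Rightarrow> 'm set \<Rightarrow> nat set \<Rightarrow> (nat \<Rightarrow> 'v set) \<Rightarrow> ('v \<Rightarrow> 'm) \<Rightarrow> bool"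
  where
  "independent L M C w X b \<longleftrightarrow>
     (\<forall>i\<in>w. \<not> forks L M C (X i) (tp L M (C \<union> (\<Union>j\<in>w - {i}. b ` X j)) (X i) b))"

text \<open>The tree of parameters is indexed by finite sequences of natural numbers; the branch
  \<open>\<sigma>\<close> consists of the nonempty initial segments of \<open>\<sigma>\<close>.\<close>

definition tree_property :: "('f, 'r, 'm) struct \<Rightarrow> ('f, 'r, nat + nat) fm \<Rightarrow> bool" where
  "tree_property M \<phi> \<longleftrightarrow>
     (\<exists>k. \<exists>c :: nat list \<Rightarrow> nat \<Rightarrow> 'm.
        (\<forall>s. k_inconsistent M k (\<lambda>i. inst (c (s @ [i])) \<phi>)) \<and>
        (\<forall>\<sigma> :: nat \<Rightarrow> nat. consistent M {inst (c (map \<sigma> [0..<n])) \<phi> | n. 0 < n}))"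

text \<open>Simplicity of the complete theory of \<open>M\<close>, for a monster model \<open>M\<close>.\<close>

definition simple_theory :: "('f, 'r) lang \<Rightarrow> ('f, 'r, 'm) struct \<Rightarrow> bool" where
  "simple_theory L M \<longleftrightarrow> (\<forall>\<phi>\<in>fmls L UNIV UNIV. \<not> tree_property M \<phi>)"

section \<open>Amalgamation systems\<close>

definition amalgamation_system ::
  "('f, 'r) lang \<Rightarrow> ('f, 'r, 'm) struct \<Rightarrow> 'm set \<Rightarrow> nat set set \<Rightarrow>
   (nat set \<Rightarrow> 'v set) \<Rightarrow> (nat set \<Rightarrow> ('f, 'r, 'v + 'm) fm set) \<Rightarrow> bool" where
  "amalgamation_system L M C W x p \<longleftrightarrow>
     finite W \<and> (\<forall>w\<in>W. \<forall>v\<subseteq>w. v \<in> W) \<and>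
     (\<forall>w\<in>W. complete_type L M C (x w) (p w)) \<and>
     (\<forall>w\<in>W. \<forall>y\<in>x w. \<forall>z\<in>x w. y \<noteq> z \<longrightarrow>
        proves_disj M (p w) {Neg (Eq (At (Inl y)) (At (Inl z)))}) \<and>
     (\<forall>v\<in>W. \<forall>w\<in>W. x v \<inter> x w = x (v \<inter> w)) \<and>
     (\<forall>v\<in>W. \<forall>w\<in>W. v \<subseteq> w \<longrightarrow> p w \<inter> fmls L (x v) C = p v) \<and>
     (\<forall>w\<in>W. \<forall>b. realizes M b (p w) \<longrightarrow>
        independent L M C w (\<lambda>i. x {i}) b \<and>
        b ` x w \<subseteq> acl L M (C \<union> (\<Union>i\<in>w. b ` x {i})))"

end

theory Submission
  imports Defs
begin

text \<open>
  Let \<open>b\<close> realize \<open>q\<^sub>w\<close>, fix \<open>i \<in> w\<close> and let \<open>a\<close> consist of the \<open>b\<^sub>j\<close> with \<open>j \<noteq> i\<close>. Since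
  \<open>tp(b\<^sub>i/Aa)\<close> does not fork over \<open>A\<close>, some \<open>e\<^sub>i\<close> realizing it is such that \<open>tp(e\<^sub>i/Ba)\<close> does not
  fork over \<open>A\<close>; an automorphism over \<open>Aa\<close> taking \<open>b\<^sub>i\<close> to \<open>e\<^sub>i\<close> takes \<open>b\<close> to a realization
  \<open>e\<close> of \<open>p\<^sub>w\<close>. As \<open>tp(a/B)\<close> does not fork over \<open>A\<close> and \<open>e\<close> is algebraic over \<open>Aae\<^sub>i\<close>, left
  transitivity of nonforking shows that \<open>tp(e/B)\<close> does not fork over \<open>A\<close>. By uniqueness it is
  \<open>q\<^sub>w = tp(b/B)\<close>, so \<open>tp(b\<^sub>i/Ba)\<close> does not fork over \<open>A\<close>, and a fortiori not over \<open>B\<close>.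

  Left transitivity rests on the following: if \<open>\<phi>(x, d)\<close> divides over \<open>A\<close> and \<open>tp(a/Ad)\<close> does not
  fork over \<open>A\<close>, then \<open>\<phi>(x, d)\<close> divides over \<open>Aa\<close>. Moving the base upwards in this way
  eventually makes the realization of \<open>\<phi>(x, d)\<close> algebraic over the base, where it can satisfy no
  dividing formula.
\<close>

section \<open>Syntax and types\<close>

lemma val_cong:
  "(\<And>a. a \<in> atms_tm t \<Longrightarrow> e a = e' a) \<Longrightarrow> val M e vs t = val M e' vs t"
proof (induction t)
  case (Fn f ts)
  then have "map (val M e vs) ts = map (val M e' vs) ts" by auto
  then show ?case by (simp del: map_eq_conv)
qed auto

lemma sat_cong:
  "(\<And>a. a \<in> atms_fm \<phi> \<Longrightarrow> e a = e' a) \<Longrightarrow> sat M e vs \<phi> \<longleftrightarrow> sat M e' vs \<phi>"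
proof (induction \<phi> arbitrary: vs)
  case (Eq s t)
  have "val M e vs s = val M e' vs s" "val M e vs t = val M e' vs t"
    by (rule val_cong; simp add: Eq)+
  then show ?case by simp
next
  case (Rl r ts)
  then have "map (val M e vs) ts = map (val M e' vs) ts" by (auto intro!: val_cong)
  then show ?case by (simp del: map_eq_conv)
qed auto

lemma val_map: "val M e vs (map_tm \<sigma> t) = val M (e \<circ> \<sigma>) vs t"
proof (induction t)
  case (Fn f ts)
  then have "map (val M e vs) (map (map_tm \<sigma>) ts) = map (val M (e \<circ> \<sigma>) vs) ts" by (auto simp: o_def)
  then show ?case by (simp del: map_eq_conv map_map comp_apply)
qed auto

lemma sat_map: "sat M e vs (map_fm \<sigma> \<phi>) \<longleftrightarrow> sat M (e \<circ> \<sigma>) vs \<phi>"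
proof (induction \<phi> arbitrary: vs)
  case (Rl r ts)
  have "map (val M e vs) (map (map_tm \<sigma>) ts) = map (val M (e \<circ> \<sigma>) vs) ts" by (auto simp: val_map)
  then show ?case by (simp del: map_eq_conv map_map comp_apply)
qed (auto simp: val_map simp del: comp_apply)

lemma wft_map [simp]: "wft L k (map_tm \<sigma> t) \<longleftrightarrow> wft L k t"
  by (induction t) (auto simp: list_all_iff)

lemma wff_map [simp]: "wff L k (map_fm \<sigma> \<phi>) \<longleftrightarrow> wff L k \<phi>"
  by (induction \<phi> arbitrary: k) (auto simp: list_all_iff)

lemma finite_atms_tm [simp]: "finite (atms_tm t)"
  by (induction t) auto

lemma finite_atms_fm [simp]: "finite (atms_fm \<phi>)"
  by (induction \<phi>) auto

text \<open>Replaces the atom \<open>a\<close> by a bound variable, \<open>k\<close> being the number of binders passed so far. No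
  index has to be shifted, because this is only applied to terms and formulas whose own bound
  indices are below \<open>k\<close>.\<close>

primrec abst_tm :: "'a \<Rightarrow> nat \<Rightarrow> ('f, 'a) tm \<Rightarrow> ('f, 'a) tm" where
  "abst_tm a k (Bd i) = Bd i"
| "abst_tm a k (At b) = (if b = a then Bd k else At b)"
| "abst_tm a k (Fn f ts) = Fn f (map (abst_tm a k) ts)"

primrec abst_fm :: "'a \<Rightarrow> nat \<Rightarrow> ('f, 'r, 'a) fm \<Rightarrow> ('f, 'r, 'a) fm" where
  "abst_fm a k (Eq s t) = Eq (abst_tm a k s) (abst_tm a k t)"
| "abst_fm a k (Rl r ts) = Rl r (map (abst_tm a k) ts)"
| "abst_fm a k (Neg \<phi>) = Neg (abst_fm a k \<phi>)"
| "abst_fm a k (Conj \<phi> \<psi>) = Conj (abst_fm a k \<phi>) (abst_fm a k \<psi>)"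
| "abst_fm a k (Ex \<phi>) = Ex (abst_fm a (Suc k) \<phi>)"

lemma wft_abst: "wft L k t \<Longrightarrow> wft L (Suc k) (abst_tm a k t)"
  by (induction t) (auto simp: list_all_iff)

lemma wff_abst: "wff L k \<phi> \<Longrightarrow> wff L (Suc k) (abst_fm a k \<phi>)"
  by (induction \<phi> arbitrary: k) (auto simp: list_all_iff wft_abst)

lemma atms_abst_tm: "atms_tm (abst_tm a k t) = atms_tm t - {a}"
  by (induction t) auto

lemma atms_abst_fm: "atms_fm (abst_fm a k \<phi>) = atms_fm \<phi> - {a}"
  by (induction \<phi> arbitrary: k) (auto simp: atms_abst_tm)

lemma val_abst:
  "wft L (length vs) t \<Longrightarrow> val M e (vs @ [m]) (abst_tm a (length vs) t) = val M (e(a := m)) vs t"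
proof (induction t)
  case (Fn f ts)
  then have "map (val M e (vs @ [m])) (map (abst_tm a (length vs)) ts) = map (val M (e(a := m)) vs) ts"
    by (auto simp: list_all_iff simp del: fun_upd_apply)
  then show ?case by (simp del: map_eq_conv map_map fun_upd_apply)
qed (auto simp: nth_append)

text \<open>The new binder is to be the outermost one, so its value goes to the end of the
  environment; at \<open>vs = []\<close> this is the environment that \<open>Ex\<close>
  produces.\<close>

lemma sat_abst:
  "wff L (length vs) \<phi> \<Longrightarrow>
   sat M e (vs @ [m]) (abst_fm a (length vs) \<phi>) \<longleftrightarrow> sat M (e(a := m)) vs \<phi>"
proof (induction \<phi> arbitrary: vs)
  case (Rl r ts)
  then have "map (val M e (vs @ [m])) (map (abst_tm a (length vs)) ts) = map (val M (e(a := m)) vs) ts"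
    by (auto simp: list_all_iff val_abst)
  then show ?case by (simp del: map_eq_conv map_map fun_upd_apply)
next
  case (Ex \<phi>)
  then show ?case using Ex.IH[of "_ # vs"] by (auto simp del: fun_upd_apply)
qed (auto simp: val_abst simp del: fun_upd_apply)

lemma sat_Ex_abst:
  "wff L 0 \<phi> \<Longrightarrow> sat M e [] (Ex (abst_fm a 0 \<phi>)) \<longleftrightarrow> (\<exists>m. sat M (e(a := m)) [] \<phi>)"
  using sat_abst[of L "[]" \<phi> M e _ a] by (simp del: fun_upd_apply)

text \<open>Compactness arguments replace finite sets by single formulas. The exact set of atoms is
  recorded so that membership in \<open>fmls\<close> can be read off.\<close>

lemma finite_conjunction:
  fixes M :: "('f, 'r, 'm) struct"
  assumes "finite \<Gamma>" and "\<And>\<phi>. \<phi> \<in> \<Gamma> \<Longrightarrow> wff L 0 \<phi>"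
  obtains \<chi> where "wff L 0 \<chi>" and "atms_fm \<chi> = \<Union> (atms_fm ` \<Gamma>)"
    and "\<And>e. sat M e [] \<chi> \<longleftrightarrow> (\<forall>\<phi>\<in>\<Gamma>. sat M e [] \<phi>)"
proof -
  have "\<exists>\<chi>. wff L 0 \<chi> \<and> atms_fm \<chi> = \<Union> (atms_fm ` \<Gamma>) \<and>
      (\<forall>e. sat M e [] \<chi> \<longleftrightarrow> (\<forall>\<phi>\<in>\<Gamma>. sat M e [] \<phi>))"
    using assms
  proof (induction \<Gamma>)
    case empty
    \<comment> \<open>The empty conjunction has to be a true sentence without atoms.\<close>
    show ?case by (rule exI[of _ "Ex (Eq (Bd 0) (Bd 0))"]) simp
  next
    case (insert \<phi> \<Gamma>)
    then obtain \<chi> where "wff L 0 \<chi>" "atms_fm \<chi> = \<Union> (atms_fm ` \<Gamma>)"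
      "\<forall>e. sat M e [] \<chi> \<longleftrightarrow> (\<forall>\<phi>\<in>\<Gamma>. sat M e [] \<phi>)" by auto
    with insert.prems show ?case by (intro exI[of _ "Conj \<phi> \<chi>"]) auto
  qed
  then show ?thesis using that by blast
qed

text \<open>The atoms of \<open>S\<close> are quantified out one at a time. A block of quantifiers
  then amounts to altering the assignment on \<open>S\<close> only.\<close>

lemma finite_exists:
  fixes M :: "('f, 'r, 'm) struct"
  assumes "finite S" and "wff L 0 \<phi>"
  obtains \<chi> where "wff L 0 \<chi>" and "atms_fm \<chi> = atms_fm \<phi> - S"
    and "\<And>e. sat M e [] \<chi> \<longleftrightarrow> (\<exists>e'. (\<forall>a. a \<notin> S \<longrightarrow> e' a = e a) \<and> sat M e' [] \<phi>)"
proof -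
  have "\<exists>\<chi>. wff L 0 \<chi> \<and> atms_fm \<chi> = atms_fm \<phi> - S \<and>
      (\<forall>e. sat M e [] \<chi> \<longleftrightarrow> (\<exists>e'. (\<forall>a. a \<notin> S \<longrightarrow> e' a = e a) \<and> sat M e' [] \<phi>))"
    using assms
  proof (induction S)
    case empty
    have "(\<exists>e'. (\<forall>a. a \<notin> {} \<longrightarrow> e' a = e a) \<and> sat M e' [] \<phi>) \<longleftrightarrow> sat M e [] \<phi>" for e
    proof -
      have "(\<forall>a. a \<notin> {} \<longrightarrow> e' a = e a) \<longleftrightarrow> e' = e" for e' by (simp add: fun_eq_iff)
      then show ?thesis by (simp only:) blast
    qed
    with empty show ?case by (intro exI[of _ \<phi>] conjI allI) (simp_all only: Diff_empty)
  next
    case (insert s S)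
    then obtain \<chi> where \<chi>: "wff L 0 \<chi>" "atms_fm \<chi> = atms_fm \<phi> - S"
      and sat: "\<And>e. sat M e [] \<chi> \<longleftrightarrow> (\<exists>e'. (\<forall>a. a \<notin> S \<longrightarrow> e' a = e a) \<and> sat M e' [] \<phi>)"
      by blast
    have "sat M e [] (Ex (abst_fm s 0 \<chi>)) \<longleftrightarrow>
        (\<exists>e'. (\<forall>a. a \<notin> insert s S \<longrightarrow> e' a = e a) \<and> sat M e' [] \<phi>)" (is "?l \<longleftrightarrow> ?r") for e
    proof
      assume ?l
      then obtain m e' where "\<forall>a. a \<notin> S \<longrightarrow> e' a = (e(s := m)) a" "sat M e' [] \<phi>"
        unfolding sat_Ex_abst[OF \<chi>(1)] sat by blast
      then show ?r by (intro exI[of _ e']) auto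
    next
      assume ?r
      then obtain e' where "\<forall>a. a \<notin> insert s S \<longrightarrow> e' a = e a" "sat M e' [] \<phi>" by blast
      then show ?l unfolding sat_Ex_abst[OF \<chi>(1)] sat
        by (intro exI[of _ "e' s"] exI[of _ e'] conjI) simp_all
    qed
    moreover have "wff L 0 (Ex (abst_fm s 0 \<chi>))"
      and "atms_fm (Ex (abst_fm s 0 \<chi>)) = atms_fm \<phi> - insert s S"
      using \<chi> by (auto simp: atms_abst_fm wff_abst)
    ultimately show ?case by blast
  qed
  then show ?thesis using that by blast
qed

section \<open>Formulas with parameters and substitution of atoms\<close>

lemma holds_cong:
  assumes "\<phi> \<in> fmls L x C" and "\<And>v. v \<in> x \<Longrightarrow> e v = e' v"
  shows "holds M e \<phi> \<longleftrightarrow> holds M e' \<phi>"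
  unfolding holds_def using assms by (intro sat_cong) (auto simp: fmls_def)

lemma holds_inst: "holds M e (inst d \<phi>) \<longleftrightarrow> sat M (case_sum e d) [] \<phi>"
proof -
  have "case_sum e id \<circ> map_sum id d = case_sum e d" by (auto split: sum.splits)
  then show ?thesis unfolding holds_def inst_def sat_map by simp
qed

lemma holds_Neg [simp]: "holds M e (Neg \<phi>) \<longleftrightarrow> \<not> holds M e \<phi>"
  by (simp add: holds_def)

lemma fmls_mono: "x \<subseteq> x' \<Longrightarrow> C \<subseteq> C' \<Longrightarrow> fmls L x C \<subseteq> fmls L x' C'"
  by (fastforce simp: fmls_def)

lemma Neg_fmls [simp]: "Neg \<phi> \<in> fmls L x C \<longleftrightarrow> \<phi> \<in> fmls L x C"
  by (simp add: fmls_def)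

lemma Eq_At_fmls: "Eq (At a) (At a') \<in> fmls L x C \<longleftrightarrow> a \<in> x <+> C \<and> a' \<in> x <+> C"
  by (auto simp: fmls_def)

lemma inst_fmls: "\<phi> \<in> fmls L x N \<Longrightarrow> d ` N \<subseteq> C \<Longrightarrow> inst d \<phi> \<in> fmls L x C"
  by (fastforce simp: fmls_def inst_def fm.set_map)

lemma map_fmls:
  assumes "\<phi> \<in> fmls L x C" and "\<And>v. v \<in> x \<Longrightarrow> \<sigma> (Inl v) \<in> y <+> D"
    and "\<And>c. c \<in> C \<Longrightarrow> \<sigma> (Inr c) \<in> y <+> D"
  shows "map_fm \<sigma> \<phi> \<in> fmls L y D"
  using assms by (fastforce simp: fmls_def fm.set_map)

text \<open>A substitution preserves truth as soon as each new atom denotes what the old one did,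
  even when it turns variables into parameters or parameters into variables. Most later exchanges of
  the two rest on this.\<close>

lemma holds_map:
  assumes "\<phi> \<in> fmls L x C" and "\<And>v. v \<in> x \<Longrightarrow> case_sum e id (\<sigma> (Inl v)) = e' v"
    and "\<And>c. c \<in> C \<Longrightarrow> case_sum e id (\<sigma> (Inr c)) = c"
  shows "holds M e (map_fm \<sigma> \<phi>) \<longleftrightarrow> holds M e' \<phi>"
  unfolding holds_def sat_map using assms by (intro sat_cong) (auto simp: fmls_def)

section \<open>Automorphisms and types of tuples\<close>

lemma val_automorphism:
  assumes "automorphism L M g"
  shows "wft L (length vs) t \<Longrightarrow> val M (g \<circ> e) (map g vs) t = g (val M e vs t)"
proof (induction t)
  case (Fn f ts)
  then have "map (val M (g \<circ> e) (map g vs)) ts = map g (map (val M e vs) ts)"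
    by (auto simp: list_all_iff o_def)
  then show ?case using Fn.prems assms unfolding automorphism_def
    by (simp del: map_eq_conv map_map comp_apply)
qed auto

text \<open>Injectivity of \<open>g\<close> gives the case of equality, and surjectivity that of the
  quantifier. Well-formedness enters because \<open>g\<close> commutes only with symbols of
  \<open>L\<close> at their arities, and with list lookup at indices within range.\<close>

lemma sat_automorphism:
  assumes g: "automorphism L M g"
  shows "wff L (length vs) \<phi> \<Longrightarrow> sat M (g \<circ> e) (map g vs) \<phi> \<longleftrightarrow> sat M e vs \<phi>"
proof (induction \<phi> arbitrary: vs)
  case (Eq s t)
  moreover have "inj g" using g by (simp add: automorphism_def bij_is_inj)
  ultimately show ?case by (simp add: val_automorphism[OF g] inj_eq del: comp_apply)
next
  case (Rl r ts)
  then have "map (val M (g \<circ> e) (map g vs)) ts = map g (map (val M e vs) ts)"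
    by (auto simp: list_all_iff val_automorphism[OF g])
  then show ?case using Rl.prems g unfolding automorphism_def
    by (simp del: map_eq_conv map_map comp_apply)
next
  case (Ex \<phi>)
  have "surj g" using g by (simp add: automorphism_def bij_is_surj)
  then have "(\<exists>a. sat M (g \<circ> e) (a # map g vs) \<phi>) \<longleftrightarrow> (\<exists>a. sat M (g \<circ> e) (g a # map g vs) \<phi>)"
    by (metis surjD)
  then show ?case using Ex.IH[of "_ # vs"] Ex.prems by (simp del: comp_apply)
qed (auto simp del: comp_apply)

lemma holds_automorphism:
  assumes "automorphism L M g" and "wff L 0 \<phi>"
  shows "holds M (g \<circ> e) (map_fm (map_sum id g) \<phi>) \<longleftrightarrow> holds M e \<phi>"
proof -
  have "case_sum (g \<circ> e) id \<circ> map_sum id g = g \<circ> case_sum e id" by (auto split: sum.splits)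
  then show ?thesis
    using sat_automorphism[OF assms(1), of "[]"] assms(2) by (simp add: holds_def sat_map)
qed

lemma map_param_fixed:
  assumes "\<phi> \<in> fmls L x C" and "\<And>c. c \<in> C \<Longrightarrow> g c = c"
  shows "map_fm (map_sum id g) \<phi> = \<phi>"
proof -
  have "map_fm (map_sum id g) \<phi> = map_fm id \<phi>"
    using assms by (intro fm.map_cong0) (auto simp: fmls_def)
  then show ?thesis by (simp add: fm.map_id0)
qed

lemma tp_automorphism:
  assumes g: "automorphism L M g" and "\<And>c. c \<in> C \<Longrightarrow> g c = c"
  shows "tp L M C x (g \<circ> b) = tp L M C x b"
proof -
  have "holds M (g \<circ> b) \<phi> \<longleftrightarrow> holds M b \<phi>" if "\<phi> \<in> fmls L x C" for \<phi>
    using holds_automorphism[OF g, of \<phi> b] map_param_fixed[OF that assms(2)] that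
    by (simp add: fmls_def)
  then show ?thesis by (auto simp: tp_def)
qed

lemma tp_cong: "(\<And>v. v \<in> x \<Longrightarrow> b v = b' v) \<Longrightarrow> tp L M C x b = tp L M C x b'"
  unfolding tp_def using holds_cong by blast

lemma tp_eqD:
  "tp L M C x b = tp L M C x b' \<Longrightarrow> \<phi> \<in> fmls L x C \<Longrightarrow> holds M b \<phi> \<longleftrightarrow> holds M b' \<phi>"
  by (auto simp: tp_def)

lemma tp_eq_mono:
  assumes "tp L M C x b = tp L M C x b'" and "C' \<subseteq> C" and "x' \<subseteq> x"
  shows "tp L M C' x' b = tp L M C' x' b'"
  using tp_eqD[OF assms(1)] fmls_mono[OF assms(3,2)] by (auto simp: tp_def)

lemma tp_mono: "C' \<subseteq> C \<Longrightarrow> x' \<subseteq> x \<Longrightarrow> tp L M C' x' b \<subseteq> tp L M C x b"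
  using fmls_mono[of x' x C' C] by (auto simp: tp_def)

section \<open>Complete types and extension to complete types\<close>

lemma complete_type_tp: "complete_type L M C x (tp L M C x b)"
  unfolding complete_type_def consistent_def tp_def by auto

text \<open>Completeness puts each formula or its negation into \<open>p\<close>, and the
  realization decides which.\<close>

lemma complete_type_realized:
  assumes "complete_type L M C x p" and "realizes M b p"
  shows "p = tp L M C x b"
  using assms holds_Neg unfolding complete_type_def realizes_def tp_def by blast

lemma consistent_mono: "consistent M \<Gamma> \<Longrightarrow> \<Delta> \<subseteq> \<Gamma> \<Longrightarrow> consistent M \<Delta>"
  unfolding consistent_def by blast

lemma inconsistent_insertE:
  assumes "\<not> consistent M (insert \<phi> p)"
  obtains \<Gamma> where "\<Gamma> \<subseteq> p" and "finite \<Gamma>" and "\<And>e. (\<forall>\<chi>\<in>\<Gamma>. holds M e \<chi>) \<Longrightarrow> \<not> holds M e \<phi>"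
proof -
  obtain \<Gamma> where \<Gamma>: "\<Gamma> \<subseteq> insert \<phi> p" "finite \<Gamma>" "\<not> (\<exists>e. \<forall>\<chi>\<in>\<Gamma>. holds M e \<chi>)"
    using assms unfolding consistent_def by auto
  show ?thesis
  proof (rule that[of "\<Gamma> - {\<phi>}"])
    show "\<not> holds M e \<phi>" if "\<forall>\<chi>\<in>\<Gamma> - {\<phi>}. holds M e \<chi>" for e
      using \<Gamma>(3) that by blast
  qed (use \<Gamma> in auto)
qed

text \<open>By Zorn's lemma there is a maximal consistent set containing \<open>\<Gamma>\<close>. If
  it decided some formula neither way, finite parts of it would refute the formula and its negation,
  and the union of these parts would be unsatisfiable.\<close>

lemma complete_extension:
  assumes \<Gamma>: "\<Gamma> \<subseteq> fmls L x C" and con: "consistent M \<Gamma>"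
  obtains p where "\<Gamma> \<subseteq> p" and "complete_type L M C x p"
proof -
  define \<A> where "\<A> = {p. \<Gamma> \<subseteq> p \<and> p \<subseteq> fmls L x C \<and> consistent M p}"
  have "\<exists>p\<in>\<A>. \<forall>X\<in>\<A>. p \<subseteq> X \<longrightarrow> X = p"
  proof (rule subset_Zorn_nonempty)
    show "\<A> \<noteq> {}" using \<Gamma> con by (auto simp: \<A>_def)
  next
    fix \<C> assume \<C>: "\<C> \<noteq> {}" "subset.chain \<A> \<C>"
    have "consistent M (\<Union>\<C>)" unfolding consistent_def
    proof (intro allI impI)
      fix \<Gamma>\<^sub>0 assume "\<Gamma>\<^sub>0 \<subseteq> \<Union>\<C>" "finite \<Gamma>\<^sub>0"
      with \<C> obtain p where "p \<in> \<C>" "\<Gamma>\<^sub>0 \<subseteq> p" by (meson finite_subset_Union_chain)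
      moreover have "p \<in> \<A>" using \<C> \<open>p \<in> \<C>\<close> by (auto simp: subset_chain_def)
      ultimately show "\<exists>e. \<forall>\<phi>\<in>\<Gamma>\<^sub>0. holds M e \<phi>"
        using \<open>finite \<Gamma>\<^sub>0\<close> by (auto simp: \<A>_def consistent_def)
    qed
    then show "\<Union>\<C> \<in> \<A>" using \<C> by (auto simp: \<A>_def subset_chain_def)
  qed
  then obtain p where p: "p \<in> \<A>" and max: "\<And>X. X \<in> \<A> \<Longrightarrow> p \<subseteq> X \<Longrightarrow> X = p" by blast
  have "\<phi> \<in> p \<or> Neg \<phi> \<in> p" if \<phi>: "\<phi> \<in> fmls L x C" for \<phi>
  proof (rule ccontr)
    assume *: "\<not> (\<phi> \<in> p \<or> Neg \<phi> \<in> p)"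
    have "\<not> consistent M (insert \<chi> p)" if "\<chi> \<in> fmls L x C" "\<chi> \<notin> p" for \<chi>
      using max[of "insert \<chi> p"] p that unfolding \<A>_def by blast
    with * \<phi> have "\<not> consistent M (insert \<phi> p)" "\<not> consistent M (insert (Neg \<phi>) p)" by auto
    then obtain \<Gamma>\<^sub>1 \<Gamma>\<^sub>2 where
      \<Gamma>\<^sub>1: "\<Gamma>\<^sub>1 \<subseteq> p" "finite \<Gamma>\<^sub>1" "\<And>e. (\<forall>\<chi>\<in>\<Gamma>\<^sub>1. holds M e \<chi>) \<Longrightarrow> \<not> holds M e \<phi>" and
      \<Gamma>\<^sub>2: "\<Gamma>\<^sub>2 \<subseteq> p" "finite \<Gamma>\<^sub>2" "\<And>e. (\<forall>\<chi>\<in>\<Gamma>\<^sub>2. holds M e \<chi>) \<Longrightarrow> \<not> holds M e (Neg \<phi>)"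
      by (elim inconsistent_insertE) blast
    have "\<Gamma>\<^sub>1 \<union> \<Gamma>\<^sub>2 \<subseteq> p" "finite (\<Gamma>\<^sub>1 \<union> \<Gamma>\<^sub>2)" using \<Gamma>\<^sub>1 \<Gamma>\<^sub>2 by auto
    moreover have "consistent M p" using p by (simp add: \<A>_def)
    ultimately obtain e where "\<forall>\<chi>\<in>\<Gamma>\<^sub>1 \<union> \<Gamma>\<^sub>2. holds M e \<chi>" unfolding consistent_def by meson
    then show False using \<Gamma>\<^sub>1(3)[of e] \<Gamma>\<^sub>2(3)[of e] by simp
  qed
  with p show ?thesis using that by (auto simp: \<A>_def complete_type_def)
qed

section \<open>Saturation and homogeneity\<close>

lemma small_subset: "small \<kappa> X \<Longrightarrow> Y \<subseteq> X \<Longrightarrow> small \<kappa> Y"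
  unfolding small_def using card_of_mono1 ordLeq_ordLess_trans by blast

lemma small_image: "small \<kappa> X \<Longrightarrow> small \<kappa> (f ` X)"
  unfolding small_def using card_of_image ordLeq_ordLess_trans by blast

locale monster =
  fixes L :: "('f, 'r) lang" and T :: "('f, 'r, nat) fm set"
    and \<kappa> :: "'k rel" and M :: "('f, 'r, 'm) struct"
  assumes monster_model: "monster_model L T \<kappa> M"
begin

lemma small_nat: "small \<kappa> (UNIV :: nat set)"
proof -
  have "small \<kappa> (funs L <+> rels L <+> (UNIV :: nat set))"
    using monster_model by (simp add: monster_model_def)
  then have "small \<kappa> ((Inr \<circ> Inr) ` (UNIV :: nat set) :: ('f + 'r + nat) set)"
    by (rule small_subset) auto
  then have "small \<kappa> (inv (Inr \<circ> Inr :: nat \<Rightarrow> 'f + 'r + nat) ` (Inr \<circ> Inr) ` (UNIV :: nat set))"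
    by (rule small_image)
  moreover have "inj (Inr \<circ> Inr :: nat \<Rightarrow> 'f + 'r + nat)" by (simp add: inj_def)
  ultimately show ?thesis by (simp only: image_inv_f_f)
qed

text \<open>Cardinal arithmetic for unions of small sets asks for an infinite
  \<open>\<kappa>\<close>; it is infinite because the set of all natural numbers is small.\<close>

lemma infinite_Field: "infinite (Field \<kappa>)"
proof
  assume "finite (Field \<kappa>)"
  have "|Field \<kappa>| =o \<kappa>" using monster_model by (simp add: monster_model_def card_of_Field_ordIso)
  then have "|UNIV :: nat set| \<le>o |Field \<kappa>|"
    using small_nat ordIso_symmetric ordLess_imp_ordLeq ordLess_ordIso_trans
    unfolding small_def by blast
  with \<open>finite (Field \<kappa>)\<close> show False using card_of_ordLeq_infinite by blast
qed

lemma small_Un: "small \<kappa> X \<Longrightarrow> small \<kappa> Y \<Longrightarrow> small \<kappa> (X \<union> Y)"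
  unfolding small_def using monster_model infinite_Field
  by (simp add: monster_model_def card_of_Un_ordLess_infinite_Field)

lemma small_finite: "finite X \<Longrightarrow> small \<kappa> X"
proof -
  assume "finite X"
  then obtain f :: "nat \<Rightarrow> 'a" and n where "X = f ` {i. i < n}"
    using finite_imp_nat_seg_image_inj_on by blast
  then show ?thesis using small_image[OF small_subset[OF small_nat, of "{i. i < n}"]] by simp
qed

lemma small_nat_nat: "small \<kappa> (UNIV :: (nat \<times> nat) set)"
  using small_nat card_of_Times_same_infinite[of "UNIV :: nat set"] ordIso_ordLess_trans
  unfolding small_def by (simp add: UNIV_Times_UNIV) blast

text \<open>Saturation only realizes types in one variable. Zorn's lemma gives a maximal partial
  realization; a missing variable could be added to it by realizing a type in one variable over
  \<open>C\<close> and the values already assigned.\<close>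

lemma complete_type_realizable:
  fixes X :: "'v set"
  assumes X: "small \<kappa> X" and C: "small \<kappa> C" and p: "complete_type L M C X p"
  obtains b where "realizes M b p"
proof -
  \<comment> \<open>\<open>G\<close> is the graph of a partial assignment. A formula with variables
    in its domain has the same truth value under all total \<open>e\<close> extending
    \<open>G\<close>, hence the quantifier over \<open>e\<close>.\<close>
  define good where "good G \<longleftrightarrow> G \<subseteq> X \<times> UNIV \<and> single_valued G \<and>
    (\<forall>\<phi>\<in>p. \<forall>e. \<phi> \<in> fmls L (Domain G) C \<longrightarrow> (\<forall>(v, m)\<in>G. e v = m) \<longrightarrow> holds M e \<phi>)" for G
  have pcon: "consistent M p" and pfm: "p \<subseteq> fmls L X C"
    using p by (auto simp: complete_type_def)
  have "\<exists>G\<in>Collect good. \<forall>H\<in>Collect good. G \<subseteq> H \<longrightarrow> H = G"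
  proof (rule subset_Zorn_nonempty)
    \<comment> \<open>A formula without variables is true under every assignment or under none, so
      consistency of \<open>p\<close> makes the empty assignment good.\<close>
    have "holds M e \<phi>" if \<phi>: "\<phi> \<in> p" "\<phi> \<in> fmls L {} C" for \<phi> e
    proof -
      have "{\<phi>} \<subseteq> p" using \<phi> by simp
      then obtain e' where "holds M e' \<phi>" using pcon unfolding consistent_def by (metis finite.emptyI finite_insert singletonI)
      then show ?thesis using holds_cong[OF \<phi>(2)] by blast
    qed
    then have "good {}" by (simp add: good_def)
    then show "Collect good \<noteq> {}" by blast
  next
    fix \<C> assume \<C>: "\<C> \<noteq> {}" "subset.chain (Collect good) \<C>"
    then have good: "good G" if "G \<in> \<C>" for G using that by (auto simp: subset_chain_def)
    have "single_valued (\<Union>\<C>)" unfolding single_valued_def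
    proof (intro allI impI)
      fix v m m' assume "(v, m) \<in> \<Union>\<C>" "(v, m') \<in> \<Union>\<C>"
      then have "finite {(v, m), (v, m')}" "{(v, m), (v, m')} \<subseteq> \<Union>\<C>" by simp_all
      with \<C> obtain G where "G \<in> \<C>" "{(v, m), (v, m')} \<subseteq> G"
        by (meson finite_subset_Union_chain)
      then show "m = m'" using good[of G] by (auto simp: good_def single_valued_def)
    qed
    moreover have "holds M e \<phi>"
      if \<phi>: "\<phi> \<in> p" "\<phi> \<in> fmls L (Domain (\<Union>\<C>)) C" and e: "\<forall>(v, m)\<in>\<Union>\<C>. e v = m" for \<phi> e
    proof -
      \<comment> \<open>Only finitely many variables occur in \<open>\<phi>\<close>, so one member
        of the chain already assigns them all.\<close>
      define F where "F = (\<lambda>v. (v, e v)) ` {v. Inl v \<in> atms_fm \<phi>}"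
      have "finite {v. Inl v \<in> atms_fm \<phi>}"
        using finite_vimageI[OF finite_atms_fm[of \<phi>], of Inl] by (simp add: vimage_def)
      then have "finite F" by (simp add: F_def)
      moreover have "F \<subseteq> \<Union>\<C>" using \<phi>(2) e by (fastforce simp: F_def fmls_def)
      ultimately obtain G where G: "G \<in> \<C>" "F \<subseteq> G"
        using \<C> by (meson finite_subset_Union_chain)
      have "\<phi> \<in> fmls L (Domain G) C" using \<phi>(2) G(2) by (fastforce simp: F_def fmls_def)
      moreover have "\<forall>(v, m)\<in>G. e v = m" using e G(1) by auto
      ultimately show ?thesis using good[OF G(1)] \<phi>(1) by (simp add: good_def)
    qed
    moreover have "\<Union>\<C> \<subseteq> X \<times> UNIV" using good by (auto simp: good_def)
    ultimately show "\<Union>\<C> \<in> Collect good" by (simp add: good_def)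
  qed
  then obtain G where G: "good G" and max: "\<And>H. good H \<Longrightarrow> G \<subseteq> H \<Longrightarrow> H = G" by blast
  define S where "S = Domain G"
  define b where "b u = (SOME m. (u, m) \<in> G)" for u
  have SX: "S \<subseteq> X" using G by (auto simp: good_def S_def)
  have bG: "(u, b u) \<in> G" if "u \<in> S" for u
    using that unfolding S_def b_def by (auto intro: someI)
  have Gb: "m = b u" if "(u, m) \<in> G" for u m
    using G bG[of u] that unfolding good_def single_valued_def S_def by blast
  have hb: "holds M b \<phi>" if "\<phi> \<in> p" "\<phi> \<in> fmls L S C" for \<phi>
  proof -
    have "\<forall>(u, m)\<in>G. b u = m" using Gb by auto
    then show ?thesis using G that by (simp add: good_def S_def)
  qed
  have "v \<in> S" if v: "v \<in> X" for v
  proof (rule ccontr)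
    assume "v \<notin> S"
    \<comment> \<open>The variable \<open>v\<close> becomes the single variable of a new type, and
      every other variable becomes the name of its value.\<close>
    define \<sigma> :: "'v + 'm \<Rightarrow> unit + 'm" where
      "\<sigma> = case_sum (\<lambda>u. if u = v then Inl () else Inr (b u)) Inr"
    define \<Gamma> where "\<Gamma> = map_fm \<sigma> ` (p \<inter> fmls L (insert v S) C)"
    have key: "holds M t (map_fm \<sigma> \<phi>) \<longleftrightarrow> holds M (b(v := t ())) \<phi>"
      if "\<phi> \<in> fmls L (insert v S) C" for t \<phi>
      using that by (rule holds_map) (auto simp: \<sigma>_def)
    have "\<Gamma> \<subseteq> fmls L UNIV (C \<union> b ` S)"
      unfolding \<Gamma>_def \<sigma>_def by (auto intro!: map_fmls)
    moreover have "consistent M \<Gamma>" unfolding consistent_def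
    proof (intro allI impI)
      fix \<Gamma>\<^sub>0 assume "\<Gamma>\<^sub>0 \<subseteq> \<Gamma>" "finite \<Gamma>\<^sub>0"
      then obtain \<Delta> where \<Delta>: "\<Delta> \<subseteq> p \<inter> fmls L (insert v S) C" "finite \<Delta>" "\<Gamma>\<^sub>0 = map_fm \<sigma> ` \<Delta>"
        unfolding \<Gamma>_def by (meson finite_subset_image)
      have "wff L 0 \<phi>" if "\<phi> \<in> \<Delta>" for \<phi> using that \<Delta>(1) by (auto simp: fmls_def)
      then obtain \<chi> where \<chi>: "wff L 0 \<chi>" "atms_fm \<chi> = \<Union> (atms_fm ` \<Delta>)"
        and sat\<chi>: "\<And>e. sat M e [] \<chi> \<longleftrightarrow> (\<forall>\<phi>\<in>\<Delta>. sat M e [] \<phi>)"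
        using finite_conjunction[OF \<Delta>(2), of L M] by metis
      \<comment> \<open>\<open>\<xi>\<close> says that some value of \<open>v\<close> satisfies all
        of \<open>\<Delta>\<close>. It belongs to \<open>p\<close>, since its negation is
        inconsistent with \<open>\<Delta>\<close>, and its variables lie in \<open>S\<close>; so
        \<open>b\<close> satisfies it.\<close>
      define \<xi> where "\<xi> = Ex (abst_fm (Inl v) 0 \<chi>)"
      have "\<xi> \<in> fmls L S C"
        using \<chi> \<Delta>(1) by (fastforce simp: \<xi>_def fmls_def atms_abst_fm wff_abst)
      moreover have "\<xi> \<in> p"
      proof (rule ccontr)
        assume "\<xi> \<notin> p"
        then have "Neg \<xi> \<in> p"
          using p \<open>\<xi> \<in> fmls L S C\<close> fmls_mono[OF SX subset_refl[of C], of L]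
          unfolding complete_type_def by blast
        then have "insert (Neg \<xi>) \<Delta> \<subseteq> p" "finite (insert (Neg \<xi>) \<Delta>)" using \<Delta> by auto
        then obtain e where e: "\<forall>\<phi>\<in>insert (Neg \<xi>) \<Delta>. holds M e \<phi>"
          using pcon unfolding consistent_def by meson
        then have "sat M (case_sum e id) [] \<chi>" by (simp add: sat\<chi> holds_def)
        then have "holds M e \<xi>" unfolding holds_def \<xi>_def sat_Ex_abst[OF \<chi>(1)]
          by (intro exI[of _ "e v"]) (simp add: fun_upd_idem)
        then show False using e by simp
      qed
      ultimately have "holds M b \<xi>" using hb by blast
      then obtain m where "sat M ((case_sum b id)(Inl v := m)) [] \<chi>"
        unfolding holds_def \<xi>_def sat_Ex_abst[OF \<chi>(1)] by blast
      moreover have "(case_sum b id)(Inl v := m) = case_sum (b(v := m)) id"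
        by (auto split: sum.splits)
      ultimately have "\<forall>\<phi>\<in>\<Delta>. holds M (b(v := m)) \<phi>" by (simp add: sat\<chi> holds_def)
      then have "\<forall>\<phi>\<in>\<Gamma>\<^sub>0. holds M (\<lambda>_. m) \<phi>" using \<Delta> key by auto
      then show "\<exists>t. \<forall>\<phi>\<in>\<Gamma>\<^sub>0. holds M t \<phi>" by blast
    qed
    ultimately obtain p1 where p1: "\<Gamma> \<subseteq> p1" "complete_type L M (C \<union> b ` S) UNIV p1"
      by (rule complete_extension)
    have "small \<kappa> (C \<union> b ` S)" using C X SX by (intro small_Un small_image) (auto intro: small_subset)
    then obtain t where t: "realizes M t p1"
      using p1(2) monster_model unfolding monster_model_def saturated_def by blast
    have "good (insert (v, t ()) G)" unfolding good_def
    proof (intro conjI ballI allI impI)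
      show "insert (v, t ()) G \<subseteq> X \<times> UNIV" using G v by (auto simp: good_def)
      show "single_valued (insert (v, t ()) G)"
        using G \<open>v \<notin> S\<close> by (auto simp: good_def single_valued_def S_def)
      fix \<phi> e
      assume \<phi>: "\<phi> \<in> p" "\<phi> \<in> fmls L (Domain (insert (v, t ()) G)) C"
        and e: "\<forall>(u, m)\<in>insert (v, t ()) G. e u = m"
      have \<phi>': "\<phi> \<in> fmls L (insert v S) C" using \<phi>(2) by (simp add: S_def)
      then have "holds M t (map_fm \<sigma> \<phi>)"
        using \<phi>(1) t p1(1) unfolding \<Gamma>_def realizes_def by blast
      then have "holds M (b(v := t ())) \<phi>" using key[OF \<phi>'] by simp
      moreover have "e u = (b(v := t ())) u" if "u \<in> insert v S" for u
        using that e bG[of u] by fastforce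
      ultimately show "holds M e \<phi>" using holds_cong[OF \<phi>'] by metis
    qed
    then have "insert (v, t ()) G = G" using max by blast
    then show False using \<open>v \<notin> S\<close> by (auto simp: S_def)
  qed
  then have "realizes M b p"
    using hb pfm SX unfolding realizes_def by (metis subsetD subsetI subset_antisym)
  then show ?thesis by (rule that)
qed

lemma consistent_realizable:
  assumes "small \<kappa> X" and "small \<kappa> C" and "\<Gamma> \<subseteq> fmls L X C" and "consistent M \<Gamma>"
  obtains b where "realizes M b \<Gamma>"
proof -
  obtain p where "\<Gamma> \<subseteq> p" "complete_type L M C X p" using complete_extension assms(3,4) by blast
  moreover from this obtain b where "realizes M b p"
    using complete_type_realizable[OF assms(1,2)] by blast
  ultimately show ?thesis using that[of b] by (auto simp: realizes_def)
qed

text \<open>Strong homogeneity concerns elementary maps on sets of elements, whereas here two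
  indexed tuples are compared over \<open>C\<close>. The map to extend is the identity on
  \<open>C\<close> and sends \<open>b v\<close> to \<open>b' v\<close>; the equality formulas in the
  type make it well defined.\<close>

lemma same_type_automorphism:
  fixes x :: "'v set"
  assumes C: "small \<kappa> C" and x: "small \<kappa> x" and eq: "tp L M C x b = tp L M C x b'"
  obtains h where "automorphism L M h" and "\<And>c. c \<in> C \<Longrightarrow> h c = c"
    and "\<And>v. v \<in> x \<Longrightarrow> h (b v) = b' v"
proof -
  define g where "g m = (if m \<in> C then m else b' (inv_into x b m))" for m
  \<comment> \<open>Elements of the domain, serving as variables, are replaced by parameters if they
    lie in \<open>C\<close>, and otherwise by variables of \<open>x\<close> whose value under
    \<open>b\<close> they are.\<close>
  define \<sigma> :: "'m + 'm \<Rightarrow> 'v + 'm" where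
    "\<sigma> = case_sum (\<lambda>m. if m \<in> C then Inr m else Inl (inv_into x b m)) Inr"
  have gb: "g (b v) = b' v" if v: "v \<in> x" for v
  proof (cases "b v \<in> C")
    case True
    then have "Eq (At (Inl v)) (At (Inr (b v))) \<in> fmls L x C" using v by (auto simp: Eq_At_fmls)
    from tp_eqD[OF eq this] True show ?thesis by (simp add: g_def holds_def)
  next
    case False
    define u where "u = inv_into x b (b v)"
    have u: "u \<in> x" "b u = b v" using v by (auto simp: u_def inv_into_into f_inv_into_f)
    then have "Eq (At (Inl v)) (At (Inl u)) \<in> fmls L x C" using v by (auto simp: Eq_At_fmls)
    from tp_eqD[OF eq this] False u show ?thesis by (simp add: g_def holds_def u_def)
  qed
  have "holds M id \<phi> \<longleftrightarrow> holds M g \<phi>" if \<phi>: "\<phi> \<in> fmls L (C \<union> b ` x) {}" for \<phi> :: "('f, 'r, 'm + 'm) fm"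
  proof -
    have "map_fm \<sigma> \<phi> \<in> fmls L x C"
      using \<phi> by (rule map_fmls) (auto simp: \<sigma>_def inv_into_into)
    then have "holds M b (map_fm \<sigma> \<phi>) \<longleftrightarrow> holds M b' (map_fm \<sigma> \<phi>)" by (rule tp_eqD[OF eq])
    moreover have "holds M b (map_fm \<sigma> \<phi>) \<longleftrightarrow> holds M id \<phi>"
      using \<phi> by (rule holds_map) (auto simp: \<sigma>_def f_inv_into_f)
    moreover have "holds M b' (map_fm \<sigma> \<phi>) \<longleftrightarrow> holds M g \<phi>"
      using \<phi> by (rule holds_map) (auto simp: \<sigma>_def g_def)
    ultimately show ?thesis by simp
  qed
  then have "tp L M {} (C \<union> b ` x) id = tp L M {} (C \<union> b ` x) g" by (auto simp: tp_def)
  moreover have "small \<kappa> (C \<union> b ` x)" by (intro small_Un small_image C x)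
  ultimately obtain h where "automorphism L M h" "\<forall>d\<in>C \<union> b ` x. h d = g d"
    using monster_model unfolding monster_model_def strongly_homogeneous_def by blast
  then show ?thesis using that[of h] gb by (auto simp: g_def)
qed

end

section \<open>Automorphisms, dividing and forking\<close>

lemma automorphism_inv:
  assumes g: "automorphism L M g"
  shows "automorphism L M (inv g)"
proof -
  have bij: "bij g" using g by (simp add: automorphism_def)
  have *: "map g (map (inv g) as) = as" for as
    using bij by (simp add: map_idI bij_is_surj surj_f_inv_f)
  have "inv g (fint M f as) = fint M f (map (inv g) as)"
    if "f \<in> funs L" "length as = far L f" for f as
  proof -
    have "g (fint M f (map (inv g) as)) = fint M f (map g (map (inv g) as))"
      using g that unfolding automorphism_def by (metis length_map)
    then show ?thesis unfolding * using bij by (metis bij_inv_eq_iff)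
  qed
  moreover have "rint M r (map (inv g) as) \<longleftrightarrow> rint M r as"
    if "r \<in> rels L" "length as = rar L r" for r as
  proof -
    have "rint M r (map g (map (inv g) as)) \<longleftrightarrow> rint M r (map (inv g) as)"
      using g that unfolding automorphism_def by (metis length_map)
    then show ?thesis unfolding * by simp
  qed
  ultimately show ?thesis using bij by (simp add: automorphism_def bij_imp_bij_inv)
qed

lemma map_param_inverse:
  fixes \<phi> :: "('f, 'r, 'v + 'm) fm"
  assumes "bij g"
  shows "map_fm (map_sum id g) (map_fm (map_sum id (inv g)) \<phi>) = \<phi>"
proof -
  have "(map_sum id g \<circ> map_sum id (inv g)) s = id s" for s :: "'v + 'm"
    using assms by (cases s) (simp_all add: bij_is_surj surj_f_inv_f)
  then have "map_sum id g \<circ> map_sum id (inv g) = (id :: 'v + 'm \<Rightarrow> 'v + 'm)" by blast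
  then show ?thesis by (simp add: fm.map_comp fm.map_id)
qed

lemma map_param_fmls: "\<phi> \<in> fmls L x C \<Longrightarrow> map_fm (map_sum id g) \<phi> \<in> fmls L x (g ` C)"
  by (rule map_fmls) auto

lemma tp_image_automorphism:
  assumes g: "automorphism L M g"
  shows "tp L M (g ` C) x (g \<circ> b) = map_fm (map_sum id g) ` tp L M C x b"
proof
  have bij: "bij g" using g by (simp add: automorphism_def)
  show "map_fm (map_sum id g) ` tp L M C x b \<subseteq> tp L M (g ` C) x (g \<circ> b)"
    using holds_automorphism[OF g] map_param_fmls by (fastforce simp: tp_def fmls_def)
  show "tp L M (g ` C) x (g \<circ> b) \<subseteq> map_fm (map_sum id g) ` tp L M C x b"
  proof
    fix \<phi> assume \<phi>: "\<phi> \<in> tp L M (g ` C) x (g \<circ> b)"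
    define \<psi> where "\<psi> = map_fm (map_sum id (inv g)) \<phi>"
    have eq: "\<phi> = map_fm (map_sum id g) \<psi>" by (simp add: \<psi>_def map_param_inverse[OF bij])
    have "\<psi> \<in> fmls L x (inv g ` g ` C)"
      using \<phi> unfolding \<psi>_def tp_def by (blast intro: map_param_fmls)
    then have "\<psi> \<in> fmls L x C" using bij by (simp add: bij_is_inj image_inv_f_f)
    moreover have "holds M b \<psi>"
      using \<phi> holds_automorphism[OF g, of \<psi> b] calculation by (simp add: eq tp_def fmls_def)
    ultimately show "\<phi> \<in> map_fm (map_sum id g) ` tp L M C x b" by (simp add: eq tp_def)
  qed
qed

lemma holds_map_automorphism:
  assumes g: "automorphism L M g" and "wff L 0 \<phi>"
  shows "holds M e (map_fm (map_sum id g) \<phi>) \<longleftrightarrow> holds M (inv g \<circ> e) \<phi>"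
proof -
  have "g \<circ> (inv g \<circ> e) = e"
    using g by (auto simp: automorphism_def bij_is_surj surj_f_inv_f)
  then show ?thesis using holds_automorphism[OF assms, of "inv g \<circ> e"] by (simp only:)
qed

lemma consistent_automorphism:
  assumes g: "automorphism L M g" and \<Gamma>: "\<And>\<phi>. \<phi> \<in> \<Gamma> \<Longrightarrow> wff L 0 \<phi>"
    and con: "consistent M (map_fm (map_sum id g) ` \<Gamma>)"
  shows "consistent M \<Gamma>"
  unfolding consistent_def
proof (intro allI impI)
  fix \<Gamma>\<^sub>0 assume \<Gamma>\<^sub>0: "\<Gamma>\<^sub>0 \<subseteq> \<Gamma>" "finite \<Gamma>\<^sub>0"
  have "map_fm (map_sum id g) ` \<Gamma>\<^sub>0 \<subseteq> map_fm (map_sum id g) ` \<Gamma>" using \<Gamma>\<^sub>0 by blast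
  moreover have "finite (map_fm (map_sum id g) ` \<Gamma>\<^sub>0)" using \<Gamma>\<^sub>0 by simp
  ultimately obtain e where "\<forall>\<phi>\<in>map_fm (map_sum id g) ` \<Gamma>\<^sub>0. holds M e \<phi>"
    using con unfolding consistent_def by meson
  then have "\<forall>\<phi>\<in>\<Gamma>\<^sub>0. holds M (inv g \<circ> e) \<phi>"
    using holds_map_automorphism[OF g] \<Gamma> \<Gamma>\<^sub>0 by (metis imageI subsetD)
  then show "\<exists>e. \<forall>\<phi>\<in>\<Gamma>\<^sub>0. holds M e \<phi>" by blast
qed

section \<open>Instances of a formula, dividing and forking\<close>

lemma inst_comp: "inst (g \<circ> d) \<phi> = map_fm (map_sum id g) (inst d \<phi>)"
  by (simp add: inst_def fm.map_comp map_sum.comp)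

lemma consistent_inst_image:
  assumes "finite I"
  shows "consistent M ((\<lambda>i. inst (c i) \<phi>) ` I) \<longleftrightarrow> (\<exists>u. \<forall>i\<in>I. sat M (case_sum u (c i)) [] \<phi>)"
    (is "?l \<longleftrightarrow> ?r")
proof
  assume ?l
  then obtain u where "\<forall>\<psi>\<in>(\<lambda>i. inst (c i) \<phi>) ` I. holds M u \<psi>"
    using assms unfolding consistent_def by (meson finite_imageI subset_refl)
  then show ?r by (auto simp: holds_inst)
next
  assume ?r
  then obtain u where "\<forall>\<psi>\<in>(\<lambda>i. inst (c i) \<phi>) ` I. holds M u \<psi>" by (auto simp: holds_inst)
  then show ?l unfolding consistent_def by blast
qed

text \<open>\<open>divides\<close> for a fixed presentation \<open>\<phi>(x, d\<^sub>0, \<dots>, d\<^sub>n\<^sub>-\<^sub>1)\<close> of the formula. The tuple \<open>d\<close> may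
  have entries which do not occur in the formula \<open>inst d \<phi>\<close>.\<close>

definition divides_inst ::
  "('f, 'r) lang \<Rightarrow> ('f, 'r, 'm) struct \<Rightarrow> 'm set \<Rightarrow> nat \<Rightarrow> (nat \<Rightarrow> 'm) \<Rightarrow> ('f, 'r, 'v + nat) fm \<Rightarrow> bool" where
  "divides_inst L M A n d \<phi> \<longleftrightarrow>
     (\<exists>k c. (\<forall>i::nat. tp L M A {..<n} (c i) = tp L M A {..<n} d) \<and>
            k_inconsistent M k (\<lambda>i. inst (c i) \<phi>))"

lemma divides_iff:
  "divides L M A x \<psi> \<longleftrightarrow> (\<exists>n. \<exists>\<phi>\<in>fmls L x {..<n}. \<exists>d. \<psi> = inst d \<phi> \<and> divides_inst L M A n d \<phi>)"
  unfolding divides_def divides_inst_def ..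

lemma divides_fmls: "divides L M A x \<psi> \<Longrightarrow> \<psi> \<in> fmls L x UNIV"
  by (auto simp: divides_iff intro: inst_fmls)

text \<open>Tuples with the type of \<open>d\<close> over \<open>B\<close> also have its type over
  each smaller base, so the same sequence is a witness. Dividing, and with it forking, thus passes
  down to smaller bases.\<close>

lemma divides_inst_antimono:
  assumes "divides_inst L M B n d \<phi>" and "A \<subseteq> B"
  shows "divides_inst L M A n d \<phi>"
proof -
  obtain k c where c: "\<forall>i::nat. tp L M B {..<n} (c i) = tp L M B {..<n} d"
    and inc: "k_inconsistent M k (\<lambda>i. inst (c i) \<phi>)"
    using assms(1) unfolding divides_inst_def by auto
  have "\<forall>i. tp L M A {..<n} (c i) = tp L M A {..<n} d"
    using tp_eq_mono[OF spec[OF c] assms(2) subset_refl] by simp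
  with inc show ?thesis unfolding divides_inst_def by auto
qed

lemma divides_mono:
  assumes "divides L M B x \<psi>" and "A \<subseteq> B" and "x \<subseteq> x'"
  shows "divides L M A x' \<psi>"
proof -
  obtain n \<phi> d where \<phi>: "\<phi> \<in> fmls L x {..<n}" "\<psi> = inst d \<phi>" "divides_inst L M B n d \<phi>"
    using assms(1) unfolding divides_iff by auto
  then have "\<phi> \<in> fmls L x' {..<n}" "divides_inst L M A n d \<phi>"
    using fmls_mono[OF assms(3) subset_refl] divides_inst_antimono[OF _ assms(2)] by auto
  with \<phi>(2) show ?thesis unfolding divides_iff by auto
qed

lemma forks_mono:
  assumes "forks L M B x \<pi>" and "A \<subseteq> B" and "x \<subseteq> x'" and "\<pi> \<subseteq> \<pi>'"
  shows "forks L M A x' \<pi>'"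
proof -
  obtain \<Psi> \<Gamma>\<^sub>0 where "finite \<Psi>" "\<forall>\<psi>\<in>\<Psi>. divides L M B x \<psi>" and "\<Gamma>\<^sub>0 \<subseteq> \<pi>" "finite \<Gamma>\<^sub>0"
    "\<forall>e. (\<forall>\<phi>\<in>\<Gamma>\<^sub>0. holds M e \<phi>) \<longrightarrow> (\<exists>\<psi>\<in>\<Psi>. holds M e \<psi>)"
    using assms(1) unfolding forks_def proves_disj_def by meson
  then show ?thesis unfolding forks_def proves_disj_def
    using divides_mono[OF _ assms(2,3)] subset_trans[OF _ assms(4)] by meson
qed

lemma divides_automorphism:
  assumes g: "automorphism L M g" and "divides L M A x \<psi>"
  shows "divides L M (g ` A) x (map_fm (map_sum id g) \<psi>)"
proof -
  obtain n \<phi> d k c where \<phi>: "\<phi> \<in> fmls L x {..<n}" "\<psi> = inst d \<phi>"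
    and c: "\<forall>i::nat. tp L M A {..<n} (c i) = tp L M A {..<n} d"
    and inc: "k_inconsistent M k (\<lambda>i. inst (c i) \<phi>)"
    using assms(2) unfolding divides_def by blast
  have "\<forall>i. tp L M (g ` A) {..<n} (g \<circ> c i) = tp L M (g ` A) {..<n} (g \<circ> d)"
    using c by (simp add: tp_image_automorphism[OF g])
  moreover have "k_inconsistent M k (\<lambda>i. inst (g \<circ> c i) \<phi>)"
    unfolding k_inconsistent_def
  proof (intro allI impI notI)
    fix I :: "nat set" assume I: "finite I \<and> card I = k" "consistent M ((\<lambda>i. inst (g \<circ> c i) \<phi>) ` I)"
    have "consistent M (map_fm (map_sum id g) ` (\<lambda>i. inst (c i) \<phi>) ` I)"
      using I(2) by (simp add: inst_comp image_image)
    moreover have "wff L 0 \<chi>" if "\<chi> \<in> (\<lambda>i. inst (c i) \<phi>) ` I" for \<chi>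
      using that \<phi>(1) by (auto simp: inst_def fmls_def)
    ultimately have "consistent M ((\<lambda>i. inst (c i) \<phi>) ` I)"
      using consistent_automorphism[OF g] by blast
    then show False using I(1) inc unfolding k_inconsistent_def by blast
  qed
  ultimately have "divides_inst L M (g ` A) n (g \<circ> d) \<phi>"
    unfolding divides_inst_def by (intro exI[of _ k] exI[of _ "\<lambda>i. g \<circ> c i"]) simp
  moreover have "map_fm (map_sum id g) \<psi> = inst (g \<circ> d) \<phi>" by (simp add: \<phi>(2) inst_comp)
  ultimately show ?thesis unfolding divides_iff using \<phi>(1) by blast
qed

lemma forks_automorphism_image:
  assumes g: "automorphism L M g" and "forks L M A x (tp L M C x b)"
  shows "forks L M (g ` A) x (tp L M (g ` C) x (g \<circ> b))"
proof -
  let ?g = "map_fm (map_sum id g)"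
  obtain \<Psi> \<Gamma>\<^sub>0 where \<Psi>: "finite \<Psi>" "\<forall>\<psi>\<in>\<Psi>. divides L M A x \<psi>"
    and \<Gamma>\<^sub>0: "\<Gamma>\<^sub>0 \<subseteq> tp L M C x b" "finite \<Gamma>\<^sub>0"
    and imp: "\<forall>e. (\<forall>\<phi>\<in>\<Gamma>\<^sub>0. holds M e \<phi>) \<longrightarrow> (\<exists>\<psi>\<in>\<Psi>. holds M e \<psi>)"
    using assms(2) unfolding forks_def proves_disj_def by meson
  have "\<exists>\<psi>\<in>?g ` \<Psi>. holds M e \<psi>" if e: "\<forall>\<phi>\<in>?g ` \<Gamma>\<^sub>0. holds M e \<phi>" for e
  proof -
    have "holds M (inv g \<circ> e) \<phi>" if "\<phi> \<in> \<Gamma>\<^sub>0" for \<phi>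
    proof -
      have "wff L 0 \<phi>" using that \<Gamma>\<^sub>0 by (auto simp: tp_def fmls_def)
      then show ?thesis using holds_map_automorphism[OF g, of \<phi> e] e that by simp
    qed
    then obtain \<psi> where "\<psi> \<in> \<Psi>" "holds M (inv g \<circ> e) \<psi>" using imp by blast
    moreover have "wff L 0 \<psi>" using \<Psi>(2) \<open>\<psi> \<in> \<Psi>\<close> divides_fmls by (fastforce simp: fmls_def)
    ultimately show ?thesis using holds_map_automorphism[OF g, of \<psi> e] by blast
  qed
  moreover have "finite (?g ` \<Psi>)" "finite (?g ` \<Gamma>\<^sub>0)" using \<Psi> \<Gamma>\<^sub>0 by auto
  moreover have "\<forall>\<psi>\<in>?g ` \<Psi>. divides L M (g ` A) x \<psi>"
    using \<Psi>(2) divides_automorphism[OF g] by blast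
  moreover have "?g ` \<Gamma>\<^sub>0 \<subseteq> tp L M (g ` C) x (g \<circ> b)"
    unfolding tp_image_automorphism[OF g] using \<Gamma>\<^sub>0(1) by blast
  ultimately show ?thesis unfolding forks_def proves_disj_def by meson
qed

lemma forks_automorphism:
  assumes g: "automorphism L M g"
  shows "forks L M (g ` A) x (tp L M (g ` C) x (g \<circ> b)) \<longleftrightarrow> forks L M A x (tp L M C x b)"
proof
  have inj: "inj g" using g by (simp add: automorphism_def bij_is_inj)
  have "inv g \<circ> (g \<circ> b) = b" using inj by auto
  moreover assume "forks L M (g ` A) x (tp L M (g ` C) x (g \<circ> b))"
  ultimately show "forks L M A x (tp L M C x b)"
    using forks_automorphism_image[OF automorphism_inv[OF g]] by (metis image_inv_f_f inj)
qed (rule forks_automorphism_image[OF g])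

section \<open>Algebraic closure and the naming of tuples\<close>

lemma acl_mono: "C \<subseteq> D \<Longrightarrow> acl L M C \<subseteq> acl L M D"
  unfolding acl_def using fmls_mono[of UNIV UNIV C D] by blast

lemma acl_automorphism:
  assumes g: "automorphism L M g" and "a \<in> acl L M C"
  shows "g a \<in> acl L M (g ` C)"
proof -
  let ?g = "map_fm (map_sum id g)"
  obtain \<theta> where \<theta>: "\<theta> \<in> fmls L (UNIV :: unit set) C" "holds M (\<lambda>_. a) \<theta>" "finite {a'. holds M (\<lambda>_. a') \<theta>}"
    using assms(2) unfolding acl_def by blast
  have eq: "holds M (\<lambda>_. g a') (?g \<theta>) \<longleftrightarrow> holds M (\<lambda>_. a') \<theta>" for a'
    using holds_automorphism[OF g, of \<theta> "\<lambda>_. a'"] \<theta>(1) by (simp add: fmls_def comp_def)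
  have "{a'. holds M (\<lambda>_. a') (?g \<theta>)} \<subseteq> g ` {a'. holds M (\<lambda>_. a') \<theta>}"
  proof
    fix m assume m: "m \<in> {a'. holds M (\<lambda>_. a') (?g \<theta>)}"
    obtain a' where "m = g a'" using g unfolding automorphism_def by (metis bij_is_surj surjD)
    then show "m \<in> g ` {a'. holds M (\<lambda>_. a') \<theta>}" using m eq by simp
  qed
  then have "finite {a'. holds M (\<lambda>_. a') (?g \<theta>)}" using \<theta>(3) finite_subset by blast
  moreover have "?g \<theta> \<in> fmls L UNIV (g ` C)" using \<theta>(1) by (rule map_param_fmls)
  moreover have "holds M (\<lambda>_. g a) (?g \<theta>)" using eq \<theta>(2) by simp
  ultimately show ?thesis unfolding acl_def by blast
qed

text \<open>Each parameter taken from \<open>a\<close> can be traded for a variable of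
  \<open>y\<close>, which turns a formula about \<open>b\<close> over the larger set into one about
  the pair of \<open>a\<close> and \<open>b\<close> over \<open>A\<close>.\<close>

lemma tp_params:
  fixes y :: "'v set" and x :: "'w set"
  assumes eq: "tp L M A (y <+> x) (case_sum a b) = tp L M A (y <+> x) (case_sum a b')"
  shows "tp L M (A \<union> a ` y) x b = tp L M (A \<union> a ` y) x b'"
proof -
  define \<sigma> :: "'w + 'c \<Rightarrow> ('v + 'w) + 'c" where
    "\<sigma> = case_sum (Inl \<circ> Inr) (\<lambda>m. if m \<in> A then Inr m else Inl (Inl (inv_into y a m)))"
  have "holds M b \<theta> \<longleftrightarrow> holds M b' \<theta>" if \<theta>: "\<theta> \<in> fmls L x (A \<union> a ` y)" for \<theta>
  proof -
    have "map_fm \<sigma> \<theta> \<in> fmls L (y <+> x) A"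
      using \<theta> by (rule map_fmls) (auto simp: \<sigma>_def inv_into_into)
    then have "holds M (case_sum a b) (map_fm \<sigma> \<theta>) \<longleftrightarrow> holds M (case_sum a b') (map_fm \<sigma> \<theta>)"
      by (rule tp_eqD[OF eq])
    moreover have "holds M (case_sum a c) (map_fm \<sigma> \<theta>) \<longleftrightarrow> holds M c \<theta>" for c
      using \<theta> by (rule holds_map) (auto simp: \<sigma>_def f_inv_into_f)
    ultimately show ?thesis by simp
  qed
  then show ?thesis by (auto simp: tp_def)
qed

section \<open>Nonforking extensions and dividing over larger bases\<close>

text \<open>Substituting \<open>d\<close> into \<open>\<rho>\<close> gives a formula in the type of
  \<open>a\<close> over \<open>C\<close>, which therefore does not divide over \<open>A\<close>. So
  the sequence \<open>c\<close> is not \<open>N\<close>-inconsistent for it: some \<open>N\<close>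
  of its members share a solution \<open>u\<close>.\<close>

lemma nonforking_consistent:
  fixes \<rho> :: "('f, 'r, ('v + nat) + 'm) fm" and a :: "'v \<Rightarrow> 'm"
  assumes nf: "\<not> forks L M A y (tp L M C y a)" and AC: "A \<subseteq> C" and dC: "d ` {..<n} \<subseteq> C"
    and c: "\<forall>i::nat. tp L M A {..<n} (c i) = tp L M A {..<n} d"
    and \<rho>: "\<rho> \<in> fmls L (y <+> {..<n}) A" and hold: "holds M (case_sum a d) \<rho>"
  obtains I u where "finite I" and "card I = N" and "\<forall>i\<in>I. holds M (case_sum u (c i)) \<rho>"
proof -
  have "finite {m. Inr m \<in> atms_fm \<rho>}"
    using finite_vimageI[OF finite_atms_fm[of \<rho>], of Inr] by (simp add: vimage_def)
  then obtain s :: "nat \<Rightarrow> 'm" and l where s: "{m. Inr m \<in> atms_fm \<rho>} = s ` {..<l}"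
    using finite_imp_nat_seg_image_inj_on by (metis lessThan_def)
  define r where "r = inv_into {..<l} s"
  have r: "r m < l" "s (r m) = m" if "Inr m \<in> atms_fm \<rho>" for m
    using that s inv_into_into[of m s "{..<l}"] f_inv_into_f[of m s "{..<l}"]
    by (auto simp: r_def)
  have sA: "s j \<in> A" if "j < l" for j
    using that s \<rho> by (auto simp: fmls_def)
  \<comment> \<open>In \<open>divides\<close> every parameter belongs to the varying tuple. The
    parameters of \<open>\<rho>\<close> from \<open>A\<close>, listed by \<open>s\<close>, are
    therefore appended at the positions from \<open>n\<close> on. They stay constant along the
    sequence and, lying in \<open>A\<close>, do not disturb equality of types over
    \<open>A\<close>.\<close>
  define ext where "ext = (\<lambda>c j. if j < n then c j else s (j - n))"
  define \<tau> :: "('v + nat) + 'm \<Rightarrow> 'v + nat" where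
    "\<tau> = case_sum id (\<lambda>m. Inr (n + r m))"
  define \<phi> where "\<phi> = map_fm \<tau> \<rho>"
  have \<phi>: "\<phi> \<in> fmls L y {..<n + l}"
    using \<rho> r(1) by (fastforce simp: \<phi>_def fmls_def fm.set_map \<tau>_def)
  have sat: "sat M (case_sum u (ext e)) [] \<phi> \<longleftrightarrow> holds M (case_sum u e) \<rho>" for u e
    unfolding \<phi>_def sat_map holds_def
  proof (rule sat_cong)
    fix t assume t: "t \<in> atms_fm \<rho>"
    then have "t \<in> (y <+> {..<n}) <+> A" using \<rho> by (auto simp: fmls_def)
    then show "(case_sum u (ext e) \<circ> \<tau>) t = case_sum (case_sum u e) id t"
      using r t by (auto simp: \<tau>_def ext_def)
  qed
  have tp_ext: "tp L M A {..<n + l} (ext (c i)) = tp L M A {..<n + l} (ext d)" for i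
  proof -
    define \<mu> :: "nat + 'm \<Rightarrow> nat + 'm" where
      "\<mu> = case_sum (\<lambda>j. if j < n then Inl j else Inr (s (j - n))) Inr"
    have "holds M (ext (c i)) \<theta> \<longleftrightarrow> holds M (ext d) \<theta>" if \<theta>: "\<theta> \<in> fmls L {..<n + l} A" for \<theta>
    proof -
      have "map_fm \<mu> \<theta> \<in> fmls L {..<n} A"
        using \<theta> by (rule map_fmls) (auto simp: \<mu>_def sA)
      then have "holds M (c i) (map_fm \<mu> \<theta>) \<longleftrightarrow> holds M d (map_fm \<mu> \<theta>)"
        by (rule tp_eqD[OF spec[OF c]])
      moreover have "holds M e (map_fm \<mu> \<theta>) \<longleftrightarrow> holds M (ext e) \<theta>" for e
        using \<theta> by (rule holds_map) (auto simp: \<mu>_def ext_def)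
      ultimately show ?thesis by simp
    qed
    then show ?thesis by (auto simp: tp_def)
  qed
  have "\<not> k_inconsistent M N (\<lambda>i. inst (ext (c i)) \<phi>)"
  proof
    assume "k_inconsistent M N (\<lambda>i. inst (ext (c i)) \<phi>)"
    then have "divides_inst L M A (n + l) (ext d) \<phi>"
      unfolding divides_inst_def using tp_ext by (intro exI[of _ N] exI[of _ "\<lambda>i. ext (c i)"]) simp
    then have div: "divides L M A y (inst (ext d) \<phi>)" unfolding divides_iff using \<phi> by blast
    have "inst (ext d) \<phi> \<in> fmls L y C"
      using \<phi> by (rule inst_fmls) (use AC dC sA in \<open>auto simp: ext_def\<close>)
    then have "inst (ext d) \<phi> \<in> tp L M C y a" using hold sat by (simp add: tp_def holds_inst)
    then have "proves_disj M (tp L M C y a) {inst (ext d) \<phi>}"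
      unfolding proves_disj_def by (intro exI[of _ "{inst (ext d) \<phi>}"]) auto
    then show False using nf div unfolding forks_def by (metis finite.emptyI finite_insert singletonD)
  qed
  then obtain I where I: "finite I" "card I = N" "consistent M ((\<lambda>i. inst (ext (c i)) \<phi>) ` I)"
    unfolding k_inconsistent_def by auto
  then obtain u where "\<forall>i\<in>I. sat M (case_sum u (ext (c i))) [] \<phi>"
    unfolding consistent_inst_image[OF I(1)] by blast
  then show ?thesis using that[of I u] I(1,2) sat by simp
qed

text \<open>Compactness can only produce a \<open>k\<close>-inconsistent sequence once this property
  is expressed by formulas. The tuples become variables \<open>(i, j)\<close>; conjoining the
  instances, quantifying out their common object variables and negating gives the formula for
  \<open>J\<close>.\<close>

lemma inconsistency_formula:
  fixes \<phi> :: "('f, 'r, 'v + nat) fm" and M :: "('f, 'r, 'm) struct"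
  assumes "finite J" and "wff L 0 \<phi>"
  obtains \<chi> :: "('f, 'r, ('v + nat \<times> nat) + 'm) fm"
    where "\<chi> \<in> fmls L (range Inr) {}"
      and "\<And>e. holds M e \<chi> \<longleftrightarrow> \<not> consistent M ((\<lambda>i. inst (\<lambda>j. e (Inr (i, j))) \<phi>) ` J)"
proof -
  \<comment> \<open>The copies share the object variables, but each has its own tuple of parameter
    variables.\<close>
  define \<iota> :: "nat \<Rightarrow> 'v + nat \<Rightarrow> ('v + nat \<times> nat) + 'm" where
    "\<iota> i = case_sum (Inl \<circ> Inl) (\<lambda>j. Inl (Inr (i, j)))" for i
  have "finite ((\<lambda>i. map_fm (\<iota> i) \<phi>) ` J)" using assms(1) by simp
  moreover have "wff L 0 \<psi>" if "\<psi> \<in> (\<lambda>i. map_fm (\<iota> i) \<phi>) ` J" for \<psi>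
    using that assms(2) by auto
  ultimately obtain \<xi> where \<xi>: "wff L 0 \<xi>" "atms_fm \<xi> = \<Union> (atms_fm ` (\<lambda>i. map_fm (\<iota> i) \<phi>) ` J)"
    and sat\<xi>: "\<And>e. sat M e [] \<xi> \<longleftrightarrow> (\<forall>\<psi>\<in>(\<lambda>i. map_fm (\<iota> i) \<phi>) ` J. sat M e [] \<psi>)"
    by (rule finite_conjunction[where M = M]) (assumption, rule that)
  define S where "S = atms_fm \<xi> \<inter> range (Inl \<circ> Inl)"
  have "finite S" by (simp add: S_def)
  from this \<xi>(1) obtain \<zeta> where \<zeta>: "wff L 0 \<zeta>" "atms_fm \<zeta> = atms_fm \<xi> - S"
    and sat\<zeta>: "\<And>e. sat M e [] \<zeta> \<longleftrightarrow> (\<exists>e'. (\<forall>a. a \<notin> S \<longrightarrow> e' a = e a) \<and> sat M e' [] \<xi>)"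
    by (rule finite_exists[where M = M]) (rule that)
  have "atms_fm \<zeta> \<subseteq> range Inr <+> {}"
  proof
    fix t assume t: "t \<in> atms_fm \<zeta>"
    then obtain i a where "t = \<iota> i a"
      unfolding \<zeta>(2) \<xi>(2) by (auto simp: fm.set_map)
    moreover have "t \<notin> range (Inl \<circ> Inl)" using t by (auto simp: \<zeta>(2) S_def)
    ultimately show "t \<in> range Inr <+> {}" by (cases a) (auto simp: \<iota>_def)
  qed
  moreover have "holds M e \<zeta> \<longleftrightarrow> consistent M ((\<lambda>i. inst (\<lambda>j. e (Inr (i, j))) \<phi>) ` J)" for e
  proof -
    have "holds M e \<zeta> \<longleftrightarrow> (\<exists>u. \<forall>i\<in>J. sat M (case_sum u (\<lambda>j. e (Inr (i, j)))) [] \<phi>)"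
    proof
      assume "holds M e \<zeta>"
      then obtain e' where e': "\<forall>a. a \<notin> S \<longrightarrow> e' a = case_sum e id a" "sat M e' [] \<xi>"
        unfolding holds_def sat\<zeta> by blast
      have "sat M (case_sum (e' \<circ> Inl \<circ> Inl) (\<lambda>j. e (Inr (i, j)))) [] \<phi>" if "i \<in> J" for i
      proof -
        have "sat M (e' \<circ> \<iota> i) [] \<phi>" using e'(2) that by (auto simp: sat\<xi> sat_map)
        moreover have "(e' \<circ> \<iota> i) a = case_sum (e' \<circ> Inl \<circ> Inl) (\<lambda>j. e (Inr (i, j))) a" for a
          using e'(1) by (cases a) (auto simp: \<iota>_def S_def)
        ultimately show ?thesis using sat_cong by metis
      qed
      then show "\<exists>u. \<forall>i\<in>J. sat M (case_sum u (\<lambda>j. e (Inr (i, j)))) [] \<phi>" by blast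
    next
      assume "\<exists>u. \<forall>i\<in>J. sat M (case_sum u (\<lambda>j. e (Inr (i, j)))) [] \<phi>"
      then obtain u where u: "\<forall>i\<in>J. sat M (case_sum u (\<lambda>j. e (Inr (i, j)))) [] \<phi>" by blast
      define e' where "e' = case_sum (case_sum u (\<lambda>ij. e (Inr ij))) id"
      have "sat M e' [] (map_fm (\<iota> i) \<phi>)" if "i \<in> J" for i
      proof -
        have "(e' \<circ> \<iota> i) a = case_sum u (\<lambda>j. e (Inr (i, j))) a" for a
          by (cases a) (auto simp: \<iota>_def e'_def)
        then show ?thesis using u that sat_cong unfolding sat_map by metis
      qed
      then have 1: "sat M e' [] \<xi>" by (auto simp: sat\<xi>)
      \<comment> \<open>Only the quantified atoms may be changed in \<open>e\<close>; on the
        remaining atoms of \<open>\<xi>\<close> the assignment \<open>e'\<close> agrees with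
        \<open>e\<close> anyway.\<close>
      define e'' where "e'' a = (if a \<in> S then e' a else case_sum e id a)" for a
      have "e'' a = e' a" if "a \<in> atms_fm \<xi>" for a
      proof -
        have "a \<in> S \<or> a \<in> range Inr <+> {}"
          using that \<open>atms_fm \<zeta> \<subseteq> range Inr <+> {}\<close> \<zeta>(2) by blast
        then show ?thesis by (auto simp: e''_def e'_def)
      qed
      then have "sat M e'' [] \<xi>" using 1 sat_cong by metis
      moreover have "\<forall>a. a \<notin> S \<longrightarrow> e'' a = case_sum e id a" by (simp add: e''_def)
      ultimately show "holds M e \<zeta>" unfolding holds_def sat\<zeta> by blast
    qed
    then show ?thesis unfolding consistent_inst_image[OF assms(1)] .
  qed
  ultimately show ?thesis using that[of "Neg \<zeta>"] \<zeta>(1) by (simp add: fmls_def)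
qed

context monster
begin

text \<open>Nonforking makes the type consistent with the negations of all formulas dividing over
  \<open>A\<close>, and a completion of this set does not fork over \<open>A\<close>. The completion
  is taken over the whole model; its restriction to the small set \<open>C \<union> D\<close> is
  realized.\<close>

lemma nonforking_realization:
  assumes C: "small \<kappa> C" and D: "small \<kappa> D" and x: "small \<kappa> x"
    and nf: "\<not> forks L M A x (tp L M C x b)"
  obtains b' where "tp L M C x b' = tp L M C x b" and "\<not> forks L M A x (tp L M (C \<union> D) x b')"
proof -
  define \<Gamma> where "\<Gamma> = tp L M C x b \<union> Neg ` {\<psi>. divides L M A x \<psi>}"
  have "\<Gamma> \<subseteq> fmls L x UNIV"
    using divides_fmls fmls_mono[of x x C UNIV L] by (auto simp: \<Gamma>_def tp_def)
  moreover have "consistent M \<Gamma>" unfolding consistent_def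
  proof (intro allI impI)
    fix \<Gamma>\<^sub>0 assume \<Gamma>\<^sub>0: "\<Gamma>\<^sub>0 \<subseteq> \<Gamma>" "finite \<Gamma>\<^sub>0"
    \<comment> \<open>The members of \<open>\<Gamma>\<^sub>0\<close> outside the type are negations
      of finitely many dividing formulas, whose disjunction the type does not prove.\<close>
    obtain \<Psi> where \<Psi>: "\<Psi> \<subseteq> {\<psi>. divides L M A x \<psi>}" "finite \<Psi>" "\<Gamma>\<^sub>0 - tp L M C x b = Neg ` \<Psi>"
      using finite_subset_image[of "\<Gamma>\<^sub>0 - tp L M C x b" Neg "{\<psi>. divides L M A x \<psi>}"] \<Gamma>\<^sub>0
      by (auto simp: \<Gamma>_def)
    have "\<not> proves_disj M (tp L M C x b) \<Psi>" using nf \<Psi>(1,2) unfolding forks_def by blast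
    moreover have "\<Gamma>\<^sub>0 \<inter> tp L M C x b \<subseteq> tp L M C x b" "finite (\<Gamma>\<^sub>0 \<inter> tp L M C x b)"
      using \<Gamma>\<^sub>0 by auto
    ultimately obtain e where "\<forall>\<phi>\<in>\<Gamma>\<^sub>0 \<inter> tp L M C x b. holds M e \<phi>" "\<forall>\<psi>\<in>\<Psi>. \<not> holds M e \<psi>"
      unfolding proves_disj_def by meson
    then have "\<forall>\<phi>\<in>\<Gamma>\<^sub>0. holds M e \<phi>" using \<Psi>(3) by (metis DiffI IntI holds_Neg imageE)
    then show "\<exists>e. \<forall>\<phi>\<in>\<Gamma>\<^sub>0. holds M e \<phi>" by blast
  qed
  ultimately obtain p where p: "\<Gamma> \<subseteq> p" "complete_type L M UNIV x p"
    by (rule complete_extension)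
  then have pcon: "consistent M p" by (simp add: complete_type_def)
  have "\<not> proves_disj M p \<Psi>" if \<Psi>: "finite \<Psi>" "\<forall>\<psi>\<in>\<Psi>. divides L M A x \<psi>" for \<Psi>
  proof
    assume "proves_disj M p \<Psi>"
    then obtain \<Gamma>\<^sub>0 where \<Gamma>\<^sub>0: "\<Gamma>\<^sub>0 \<subseteq> p" "finite \<Gamma>\<^sub>0"
      "\<forall>e. (\<forall>\<phi>\<in>\<Gamma>\<^sub>0. holds M e \<phi>) \<longrightarrow> (\<exists>\<psi>\<in>\<Psi>. holds M e \<psi>)"
      unfolding proves_disj_def by meson
    have "\<Gamma>\<^sub>0 \<union> Neg ` \<Psi> \<subseteq> p" "finite (\<Gamma>\<^sub>0 \<union> Neg ` \<Psi>)"
      using \<Gamma>\<^sub>0 \<Psi> p(1) by (auto simp: \<Gamma>_def)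
    then obtain e where "\<forall>\<phi>\<in>\<Gamma>\<^sub>0 \<union> Neg ` \<Psi>. holds M e \<phi>"
      using pcon unfolding consistent_def by meson
    then have "\<forall>\<phi>\<in>\<Gamma>\<^sub>0. holds M e \<phi>" "\<forall>\<psi>\<in>\<Psi>. \<not> holds M e \<psi>"
      by (simp_all add: ball_Un)
    then show False using \<Gamma>\<^sub>0(3) by blast
  qed
  then have nfp: "\<not> forks L M A x p" unfolding forks_def by blast
  define q where "q = p \<inter> fmls L x (C \<union> D)"
  have "complete_type L M (C \<union> D) x q"
    using p(2) consistent_mono[OF pcon, of q] fmls_mono[of x x "C \<union> D" UNIV L]
    unfolding complete_type_def q_def by auto
  moreover obtain b' where b': "realizes M b' q"
    using complete_type_realizable[OF x small_Un[OF C D] calculation] by blast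
  ultimately have q: "q = tp L M (C \<union> D) x b'" by (rule complete_type_realized)
  have "\<not> forks L M A x (tp L M (C \<union> D) x b')"
    using nfp forks_mono[of L M A x q A x p] by (auto simp: q[symmetric] q_def)
  moreover have "tp L M C x b \<subseteq> q"
    using p(1) fmls_mono[of x x C "C \<union> D" L] by (auto simp: q_def \<Gamma>_def tp_def)
  then have "realizes M b' (tp L M C x b)" using b' by (auto simp: realizes_def)
  then have "tp L M C x b' = tp L M C x b"
    using complete_type_realized[OF complete_type_tp] by metis
  ultimately show ?thesis using that by blast
qed

text \<open>By compactness, not by indiscernibles: since no formula in \<open>tp(a/Ad)\<close> divides over \<open>A\<close>,
  arbitrarily long finite parts of a sequence witnessing that \<open>\<phi>(x, d)\<close> divides over \<open>A\<close> look like
  realizations of \<open>tp(d/Aa)\<close>.\<close>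

lemma divides_inst_extend_base:
  fixes \<phi> :: "('f, 'r, 'v + nat) fm" and a :: "'v \<Rightarrow> 'm"
  assumes A: "small \<kappa> A" and y: "small \<kappa> y" and \<phi>: "\<phi> \<in> fmls L x {..<n}"
    and div: "divides_inst L M A n d \<phi>" and AC: "A \<subseteq> C" and dC: "d ` {..<n} \<subseteq> C"
    and nf: "\<not> forks L M A y (tp L M C y a)"
  shows "divides_inst L M (A \<union> a ` y) n d \<phi>"
proof -
  obtain k c where c: "\<forall>i::nat. tp L M A {..<n} (c i) = tp L M A {..<n} d"
    and inc: "k_inconsistent M k (\<lambda>i. inst (c i) \<phi>)"
    using div unfolding divides_inst_def by auto
  have wff: "wff L 0 \<phi>" using \<phi> by (simp add: fmls_def)
  \<comment> \<open>\<open>R\<close> is the type of the pair of \<open>a\<close> and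
    \<open>d\<close>. The aim is one tuple \<open>a'\<close> and a sequence \<open>c'\<close> such
    that every pair of \<open>a'\<close> and \<open>c' i\<close> realizes \<open>R\<close>,
    expressed by \<open>\<Gamma>\<^sub>1\<close>, while the instances remain
    \<open>k\<close>-inconsistent, expressed by \<open>\<Gamma>\<^sub>2\<close>.\<close>
  define R where "R = tp L M A (y <+> {..<n}) (case_sum a d)"
  define \<tau> :: "nat \<Rightarrow> ('v + nat) + 'm \<Rightarrow> ('v + nat \<times> nat) + 'm" where
    "\<tau> i = case_sum (case_sum (Inl \<circ> Inl) (\<lambda>j. Inl (Inr (i, j)))) Inr" for i
  have "\<forall>J. \<exists>\<chi>. finite J \<longrightarrow> \<chi> \<in> fmls L (range Inr :: ('v + nat \<times> nat) set) {} \<and>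
      (\<forall>e. holds M e \<chi> \<longleftrightarrow> \<not> consistent M ((\<lambda>i. inst (\<lambda>j. e (Inr (i, j))) \<phi>) ` J))"
    using inconsistency_formula[OF _ wff] by metis
  then obtain \<Xi> :: "nat set \<Rightarrow> ('f, 'r, ('v + nat \<times> nat) + 'm) fm"
    where \<Xi>: "\<forall>J. finite J \<longrightarrow> \<Xi> J \<in> fmls L (range Inr) {} \<and>
      (\<forall>e. holds M e (\<Xi> J) \<longleftrightarrow> \<not> consistent M ((\<lambda>i. inst (\<lambda>j. e (Inr (i, j))) \<phi>) ` J))"
    by metis
  define \<Gamma>\<^sub>1 where "\<Gamma>\<^sub>1 = (\<lambda>(i, \<rho>). map_fm (\<tau> i) \<rho>) ` (UNIV \<times> R)"
  define \<Gamma>\<^sub>2 where "\<Gamma>\<^sub>2 = \<Xi> ` {J. finite J \<and> card J = k}"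
  have holds_\<tau>: "holds M e (map_fm (\<tau> i) \<rho>) \<longleftrightarrow>
      holds M (case_sum (e \<circ> Inl) (\<lambda>j. e (Inr (i, j)))) \<rho>"
    if "\<rho> \<in> fmls L (y <+> {..<n}) A" for e i \<rho>
    using that by (rule holds_map) (auto simp: \<tau>_def)
  have "\<Gamma>\<^sub>1 \<subseteq> fmls L (y <+> UNIV) A"
    by (auto simp: \<Gamma>\<^sub>1_def R_def tp_def \<tau>_def intro!: map_fmls)
  moreover have "\<Gamma>\<^sub>2 \<subseteq> fmls L (y <+> UNIV) A"
    using \<Xi> fmls_mono[of "range Inr" "y <+> UNIV" "{}" A L] by (fastforce simp: \<Gamma>\<^sub>2_def)
  moreover have "consistent M (\<Gamma>\<^sub>1 \<union> \<Gamma>\<^sub>2)" unfolding consistent_def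
  proof (intro allI impI)
    fix \<Gamma>\<^sub>0 assume \<Gamma>\<^sub>0: "\<Gamma>\<^sub>0 \<subseteq> \<Gamma>\<^sub>1 \<union> \<Gamma>\<^sub>2" "finite \<Gamma>\<^sub>0"
    obtain I\<^sub>1 where I\<^sub>1: "I\<^sub>1 \<subseteq> UNIV \<times> R" "finite I\<^sub>1" "\<Gamma>\<^sub>0 \<inter> \<Gamma>\<^sub>1 = (\<lambda>(i, \<rho>). map_fm (\<tau> i) \<rho>) ` I\<^sub>1"
      using finite_subset_image[of "\<Gamma>\<^sub>0 \<inter> \<Gamma>\<^sub>1" "\<lambda>(i, \<rho>). map_fm (\<tau> i) \<rho>" "UNIV \<times> R"] \<Gamma>\<^sub>0(2)
      by (auto simp: \<Gamma>\<^sub>1_def)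
    obtain I\<^sub>2 where I\<^sub>2: "I\<^sub>2 \<subseteq> {J. finite J \<and> card J = k}" "finite I\<^sub>2" "\<Gamma>\<^sub>0 \<inter> \<Gamma>\<^sub>2 = \<Xi> ` I\<^sub>2"
      using finite_subset_image[of "\<Gamma>\<^sub>0 \<inter> \<Gamma>\<^sub>2" \<Xi> "{J. finite J \<and> card J = k}"] \<Gamma>\<^sub>0(2)
      by (auto simp: \<Gamma>\<^sub>2_def)
    have "finite (fst ` I\<^sub>1 \<union> \<Union>I\<^sub>2)" using I\<^sub>1 I\<^sub>2 by auto
    \<comment> \<open>Only the sequence members with index below \<open>N\<close> are mentioned in
      \<open>\<Gamma>\<^sub>0\<close>, so \<open>N\<close> members of \<open>c\<close> with a common
      \<open>u\<close> suffice.\<close>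
    then obtain N where N: "\<forall>i\<in>fst ` I\<^sub>1 \<union> \<Union>I\<^sub>2. i < N" by (meson finite_nat_set_iff_bounded)
    have "finite (snd ` I\<^sub>1)" using I\<^sub>1 by simp
    moreover have R1: "snd ` I\<^sub>1 \<subseteq> R" using I\<^sub>1(1) by auto
    then have "wff L 0 \<rho>" if "\<rho> \<in> snd ` I\<^sub>1" for \<rho> using that by (auto simp: R_def tp_def fmls_def)
    ultimately obtain \<chi> where \<chi>: "wff L 0 \<chi>" "atms_fm \<chi> = \<Union> (atms_fm ` snd ` I\<^sub>1)"
      and sat\<chi>: "\<And>e. sat M e [] \<chi> \<longleftrightarrow> (\<forall>\<rho>\<in>snd ` I\<^sub>1. sat M e [] \<rho>)"
      by (rule finite_conjunction[where M = M]) (assumption, rule that)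
    have "\<chi> \<in> fmls L (y <+> {..<n}) A"
      using \<chi> R1 by (fastforce simp: R_def tp_def fmls_def)
    moreover have "holds M (case_sum a d) \<chi>"
      using R1 by (auto simp: R_def tp_def holds_def sat\<chi>)
    ultimately obtain I u where I: "finite I" "card I = N" "\<forall>i\<in>I. holds M (case_sum u (c i)) \<chi>"
      by (rule nonforking_consistent[OF nf AC dC c])
    obtain \<sigma> where \<sigma>: "bij_betw \<sigma> {..<N} I"
      using ex_bij_betw_nat_finite[OF I(1)] I(2) by (auto simp: lessThan_atLeast0)
    \<comment> \<open>Place \<open>i\<close> of the new sequence is filled with
      \<open>c (\<sigma> i)\<close>. Injectivity of \<open>\<sigma>\<close> below \<open>N\<close>
      keeps the \<open>k\<close>-inconsistency of \<open>c\<close>; values at other places do not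
      matter for \<open>\<Gamma>\<^sub>0\<close>.\<close>
    define e where "e = case_sum u (\<lambda>(i, j). c (\<sigma> i) j)"
    have e_simps: "e \<circ> Inl = u" "(\<lambda>j. e (Inr (i, j))) = c (\<sigma> i)" for i by (auto simp: e_def)
    have "holds M e \<gamma>" if \<gamma>: "\<gamma> \<in> \<Gamma>\<^sub>0" for \<gamma>
    proof (cases "\<gamma> \<in> \<Gamma>\<^sub>1")
      case True
      then have "\<gamma> \<in> (\<lambda>(i, \<rho>). map_fm (\<tau> i) \<rho>) ` I\<^sub>1" using \<gamma> I\<^sub>1(3) by blast
      then obtain i \<rho> where \<rho>: "(i, \<rho>) \<in> I\<^sub>1" "\<gamma> = map_fm (\<tau> i) \<rho>" by auto
      have "i \<in> fst ` I\<^sub>1" using \<rho>(1) by force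
      then have "i \<in> {..<N}" using N by simp
      then have "\<sigma> i \<in> I" by (rule bij_betw_apply[OF \<sigma>])
      moreover have "\<rho> \<in> snd ` I\<^sub>1" using \<rho>(1) by force
      ultimately have "holds M (case_sum u (c (\<sigma> i))) \<rho>" using I(3) by (auto simp: holds_def sat\<chi>)
      moreover have "\<rho> \<in> fmls L (y <+> {..<n}) A" using R1 \<open>\<rho> \<in> snd ` I\<^sub>1\<close> by (auto simp: R_def tp_def)
      ultimately show ?thesis by (simp add: \<rho>(2) holds_\<tau> e_simps)
    next
      case False
      then have "\<gamma> \<in> \<Xi> ` I\<^sub>2" using \<gamma> \<Gamma>\<^sub>0(1) I\<^sub>2(3) by blast
      then obtain J where J: "J \<in> I\<^sub>2" "\<gamma> = \<Xi> J" by auto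
      then have "finite J" "card J = k" "J \<subseteq> {..<N}" using I\<^sub>2(1) N by auto
      moreover from this have "card (\<sigma> ` J) = k"
        using \<sigma> by (metis bij_betw_imp_inj_on card_image inj_on_subset)
      ultimately have "\<not> consistent M ((\<lambda>i. inst (c i) \<phi>) ` \<sigma> ` J)"
        using inc unfolding k_inconsistent_def by blast
      then show ?thesis using \<Xi> \<open>finite J\<close> by (simp add: J(2) e_simps image_image)
    qed
    then show "\<exists>e. \<forall>\<phi>\<in>\<Gamma>\<^sub>0. holds M e \<phi>" by blast
  qed
  moreover have "small \<kappa> (y <+> (UNIV :: (nat \<times> nat) set))"
    unfolding Plus_def by (intro small_Un small_image y small_nat_nat)
  ultimately obtain e where e: "realizes M e (\<Gamma>\<^sub>1 \<union> \<Gamma>\<^sub>2)"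
    using consistent_realizable[OF _ A] by (meson Un_least)
  define a' where "a' = e \<circ> Inl"
  define c' where "c' i j = e (Inr (i, j))" for i j
  have tp': "tp L M A (y <+> {..<n}) (case_sum a' (c' i)) = R" for i
  proof -
    have "holds M (case_sum a' (c' i)) \<rho>" if "\<rho> \<in> R" for \<rho>
    proof -
      have "map_fm (\<tau> i) \<rho> \<in> \<Gamma>\<^sub>1" using that by (auto simp: \<Gamma>\<^sub>1_def)
      then have "holds M e (map_fm (\<tau> i) \<rho>)" using e by (simp add: realizes_def)
      moreover have "\<rho> \<in> fmls L (y <+> {..<n}) A" using that by (simp add: R_def tp_def)
      moreover have "(\<lambda>j. e (Inr (i, j))) = c' i" by (auto simp: c'_def)
      ultimately show ?thesis by (simp add: holds_\<tau> a'_def)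
    qed
    then have "realizes M (case_sum a' (c' i)) R" by (simp add: realizes_def)
    then show ?thesis using complete_type_realized[OF complete_type_tp] unfolding R_def by metis
  qed
  have y_n: "small \<kappa> (y <+> {..<n})"
    unfolding Plus_def by (intro small_Un small_image y small_finite) simp
  \<comment> \<open>The tuple \<open>a'\<close> need not be \<open>a\<close>. An automorphism over
    \<open>A\<close> taking \<open>a'\<close> and \<open>c' 0\<close> to \<open>a\<close> and
    \<open>d\<close> moves the whole sequence into the type of \<open>d\<close> over
    \<open>A\<close> and \<open>a\<close>.\<close>
  obtain h where h: "automorphism L M h" "\<And>m. m \<in> A \<Longrightarrow> h m = m"
    and hv: "\<And>v. v \<in> y <+> {..<n} \<Longrightarrow> h (case_sum a' (c' 0) v) = case_sum a d v"
    using same_type_automorphism[OF A y_n tp'[of 0, unfolded R_def]] by auto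
  have ha: "h (a' v) = a v" if "v \<in> y" for v using hv[of "Inl v"] that by auto
  have "tp L M (A \<union> a ` y) {..<n} (h \<circ> c' i) = tp L M (A \<union> a ` y) {..<n} d" for i
  proof (rule tp_params)
    have "tp L M A (y <+> {..<n}) (case_sum a (h \<circ> c' i)) =
        tp L M A (y <+> {..<n}) (h \<circ> case_sum a' (c' i))"
      by (rule tp_cong) (auto simp: ha)
    also have "\<dots> = R" using tp_automorphism[OF h] tp' by metis
    finally show "tp L M A (y <+> {..<n}) (case_sum a (h \<circ> c' i)) =
        tp L M A (y <+> {..<n}) (case_sum a d)" by (simp add: R_def)
  qed
  moreover have "k_inconsistent M k (\<lambda>i. inst (h \<circ> c' i) \<phi>)"
    unfolding k_inconsistent_def
  proof (intro allI impI notI)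
    fix J :: "nat set"
    assume J: "finite J \<and> card J = k" and con: "consistent M ((\<lambda>i. inst (h \<circ> c' i) \<phi>) ` J)"
    have "consistent M (map_fm (map_sum id h) ` (\<lambda>i. inst (c' i) \<phi>) ` J)"
      using con by (simp add: inst_comp image_image)
    moreover have "wff L 0 \<chi>" if "\<chi> \<in> (\<lambda>i. inst (c' i) \<phi>) ` J" for \<chi>
      using that wff by (auto simp: inst_def)
    ultimately have "consistent M ((\<lambda>i. inst (c' i) \<phi>) ` J)"
      using consistent_automorphism[OF h(1)] by blast
    moreover have "holds M e (\<Xi> J)" using e J by (auto simp: realizes_def \<Gamma>\<^sub>2_def)
    moreover have "c' i = (\<lambda>j. e (Inr (i, j)))" for i by (auto simp: c'_def)
    ultimately show False using \<Xi> J by simp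
  qed
  ultimately show ?thesis
    unfolding divides_inst_def by (intro exI[of _ k] exI[of _ "\<lambda>i. h \<circ> c' i"]) simp
qed

text \<open>Automorphisms over \<open>C\<close> taking \<open>d\<close> to the \<open>c i\<close>
  leave only finitely many possible images for the relevant part of \<open>b\<close>. If
  \<open>b\<close> satisfied the formula, infinitely many \<open>i\<close> would give the same
  image, a common solution of their instances.\<close>

lemma algebraic_not_divides_inst:
  fixes b :: "'v \<Rightarrow> 'm"
  assumes C: "small \<kappa> C" and \<phi>: "\<phi> \<in> fmls L x {..<n}" and div: "divides_inst L M C n d \<phi>"
    and alg: "b ` x \<subseteq> acl L M C"
  shows "\<not> holds M b (inst d \<phi>)"
proof
  assume hold: "holds M b (inst d \<phi>)"
  obtain k c where c: "\<forall>i::nat. tp L M C {..<n} (c i) = tp L M C {..<n} d"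
    and inc: "k_inconsistent M k (\<lambda>i. inst (c i) \<phi>)"
    using div unfolding divides_inst_def by auto
  have "\<exists>f. automorphism L M f \<and> (\<forall>m\<in>C. f m = m) \<and> (\<forall>j<n. f (d j) = c i j)" for i
    using same_type_automorphism[OF C small_finite[OF finite_lessThan] spec[OF c, of i, symmetric]]
    by (metis lessThan_iff)
  then obtain f where f: "\<And>i. automorphism L M (f i)" "\<And>i m. m \<in> C \<Longrightarrow> f i m = m"
    "\<And>i j. j < n \<Longrightarrow> f i (d j) = c i j"
    by metis
  \<comment> \<open>The set \<open>x\<close> may be infinite, but only the finitely many coordinates
    occurring in \<open>\<phi>\<close> have to be controlled.\<close>
  define F where "F = {v. Inl v \<in> atms_fm \<phi>}"
  have "finite F"
    using finite_vimageI[OF finite_atms_fm[of \<phi>], of Inl] by (simp add: vimage_def F_def)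
  have "F \<subseteq> x" using \<phi> by (auto simp: F_def fmls_def)
  then have "\<forall>v\<in>F. \<exists>\<theta>\<in>fmls L (UNIV :: unit set) C. holds M (\<lambda>_. b v) \<theta> \<and> finite {m. holds M (\<lambda>_. m) \<theta>}"
    using alg unfolding acl_def by blast
  then obtain \<theta> where \<theta>: "\<And>v. v \<in> F \<Longrightarrow> \<theta> v \<in> fmls L (UNIV :: unit set) C"
    "\<And>v. v \<in> F \<Longrightarrow> holds M (\<lambda>_. b v) (\<theta> v)" "\<And>v. v \<in> F \<Longrightarrow> finite {m. holds M (\<lambda>_. m) (\<theta> v)}"
    by metis
  define Z where "Z = (\<Union>v\<in>F. {m. holds M (\<lambda>_. m) (\<theta> v)})"
  have "finite Z" using \<open>finite F\<close> \<theta>(3) by (simp add: Z_def)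
  have fZ: "f i (b v) \<in> Z" if "v \<in> F" for i v
  proof -
    have "tp L M C (UNIV :: unit set) (f i \<circ> (\<lambda>_. b v)) = tp L M C UNIV (\<lambda>_. b v)"
      by (rule tp_automorphism[OF f(1,2)])
    then have "holds M (f i \<circ> (\<lambda>_. b v)) (\<theta> v)" using \<theta>(1,2)[OF that] tp_eqD by metis
    then show ?thesis using that by (auto simp: Z_def comp_def)
  qed
  \<comment> \<open>The default \<open>undefined\<close> outside \<open>F\<close> leaves only
    finitely many functions \<open>r i\<close>, as the pigeonhole principle requires.\<close>
  define r where "r i v = (if v \<in> F then f i (b v) else undefined)" for i v
  have "range r \<subseteq> {s. \<forall>v. (v \<in> F \<longrightarrow> s v \<in> Z) \<and> (v \<notin> F \<longrightarrow> s v = undefined)}"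
    using fZ by (auto simp: r_def)
  then have "finite (range r)"
    using finite_set_of_finite_funs[OF \<open>finite F\<close> \<open>finite Z\<close>] finite_subset by blast
  then obtain i\<^sub>0 where "infinite {i. r i = r i\<^sub>0}"
    using pigeonhole_infinite[of UNIV r] by auto
  then obtain I where I: "finite I" "card I = k" "I \<subseteq> {i. r i = r i\<^sub>0}"
    using infinite_arbitrarily_large by blast
  have "sat M (case_sum (r i\<^sub>0) (c i)) [] \<phi>" if "i \<in> I" for i
  proof -
    have "sat M (case_sum b d) [] \<phi>" using hold by (simp add: holds_inst)
    then have "sat M (f i \<circ> case_sum b d) [] \<phi>"
      using sat_automorphism[OF f(1)[of i], of "[]" \<phi> "case_sum b d"] \<phi>
      unfolding fmls_def list.map list.size by blast
    moreover have "(f i \<circ> case_sum b d) t = case_sum (r i\<^sub>0) (c i) t" if t: "t \<in> atms_fm \<phi>" for t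
    proof -
      have "r i = r i\<^sub>0" using \<open>i \<in> I\<close> I(3) by auto
      moreover have "t \<in> x <+> {..<n}" using t \<phi> by (auto simp: fmls_def)
      ultimately show ?thesis using t by (auto simp: f(3) F_def r_def fun_eq_iff split: if_splits)
    qed
    ultimately show ?thesis using sat_cong by metis
  qed
  then have "consistent M ((\<lambda>i. inst (c i) \<phi>) ` I)"
    unfolding consistent_inst_image[OF I(1)] by blast
  then show False using inc I unfolding k_inconsistent_def by blast
qed

end

section \<open>Left transitivity and uniqueness\<close>

context monster
begin

text \<open>The parameters \<open>D\<close> of a forking disjunction need not lie in
  \<open>B\<close>. Moving the tuple by automorphisms over \<open>B\<close> makes both nonforking
  hypotheses hold with \<open>D\<close> added; dividing then lifts past the part in \<open>y\<close>
  and the part in \<open>x\<close>, to a base over which the tuple is algebraic.\<close>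

lemma nonforking_left_transitive:
  fixes b :: "'v \<Rightarrow> 'm"
  assumes AB: "A \<subseteq> B" and B: "small \<kappa> B" and x: "small \<kappa> x" and y: "small \<kappa> y"
    and nf_y: "\<not> forks L M A y (tp L M B y b)"
    and nf_x: "\<not> forks L M (A \<union> b ` y) x (tp L M (B \<union> b ` y) x b)"
    and alg: "b ` z \<subseteq> acl L M (A \<union> b ` y \<union> b ` x)"
  shows "\<not> forks L M A z (tp L M B z b)"
proof
  assume "forks L M A z (tp L M B z b)"
  then obtain \<Psi> \<Gamma>\<^sub>0 where \<Psi>: "finite \<Psi>" "\<forall>\<psi>\<in>\<Psi>. divides L M A z \<psi>"
    and \<Gamma>\<^sub>0: "\<Gamma>\<^sub>0 \<subseteq> tp L M B z b"
    and imp: "\<forall>e. (\<forall>\<phi>\<in>\<Gamma>\<^sub>0. holds M e \<phi>) \<longrightarrow> (\<exists>\<psi>\<in>\<Psi>. holds M e \<psi>)"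
    unfolding forks_def proves_disj_def by meson
  have "\<forall>\<psi>\<in>\<Psi>. \<exists>n \<phi> d. \<phi> \<in> fmls L z {..<n} \<and> \<psi> = inst d \<phi> \<and> divides_inst L M A n d \<phi>"
    using \<Psi>(2) unfolding divides_iff by blast
  then obtain n \<phi> d where pres: "\<forall>\<psi>\<in>\<Psi>. \<phi> \<psi> \<in> fmls L z {..<n \<psi>} \<and> \<psi> = inst (d \<psi>) (\<phi> \<psi>) \<and>
      divides_inst L M A (n \<psi>) (d \<psi>) (\<phi> \<psi>)"
    by metis
  \<comment> \<open>Which disjunct holds is known only after the tuple has been moved, so the
    parameters of all of them are collected.\<close>
  define D where "D = (\<Union>\<psi>\<in>\<Psi>. d \<psi> ` {..<n \<psi>})"
  have D: "small \<kappa> D" using \<Psi>(1) by (intro small_finite) (simp add: D_def)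
  have A: "small \<kappa> A" using small_subset[OF B AB] .
  obtain b\<^sub>1 where b\<^sub>1: "tp L M B y b\<^sub>1 = tp L M B y b" "\<not> forks L M A y (tp L M (B \<union> D) y b\<^sub>1)"
    using nonforking_realization[OF B D y nf_y] by blast
  obtain g where g: "automorphism L M g" "\<And>m. m \<in> B \<Longrightarrow> g m = m" "\<And>v. v \<in> y \<Longrightarrow> g (b v) = b\<^sub>1 v"
    using same_type_automorphism[OF B y b\<^sub>1(1)[symmetric]] by auto
  \<comment> \<open>Moving the whole tuple, not only its part in \<open>y\<close>, carries along the
    hypothesis on \<open>x\<close> and the algebraicity.\<close>
  define b\<^sub>2 where "b\<^sub>2 = g \<circ> b"
  have gA: "g ` A = A" and gB: "g ` B = B" using g(2) AB by force+
  have by2: "small \<kappa> (B \<union> b\<^sub>2 ` y)" by (intro small_Un small_image B y)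
  have "\<not> forks L M (A \<union> b\<^sub>2 ` y) x (tp L M (B \<union> b\<^sub>2 ` y) x b\<^sub>2)"
    using nf_x forks_automorphism[OF g(1), of "A \<union> b ` y" x "B \<union> b ` y" b]
    by (simp add: b\<^sub>2_def image_Un gA gB image_comp)
  then obtain b\<^sub>3 where b\<^sub>3: "tp L M (B \<union> b\<^sub>2 ` y) x b\<^sub>3 = tp L M (B \<union> b\<^sub>2 ` y) x b\<^sub>2"
    "\<not> forks L M (A \<union> b\<^sub>2 ` y) x (tp L M (B \<union> b\<^sub>2 ` y \<union> D) x b\<^sub>3)"
    using nonforking_realization[OF by2 D x] by blast
  obtain h where h: "automorphism L M h" "\<And>m. m \<in> B \<union> b\<^sub>2 ` y \<Longrightarrow> h m = m"
    "\<And>v. v \<in> x \<Longrightarrow> h (b\<^sub>2 v) = b\<^sub>3 v"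
    using same_type_automorphism[OF by2 x b\<^sub>3(1)[symmetric]] by auto
  \<comment> \<open>\<open>h\<close> fixes \<open>b\<^sub>2\<close> on \<open>y\<close>, so the
    second move does not undo the first.\<close>
  define b\<^sub>4 where "b\<^sub>4 = h \<circ> b\<^sub>2"
  have b4y: "b\<^sub>4 v = b\<^sub>2 v" if "v \<in> y" for v using that h(2) by (simp add: b\<^sub>4_def)
  then have b4y': "b\<^sub>4 ` y = b\<^sub>2 ` y" by simp
  have "tp L M (B \<union> D) y b\<^sub>1 = tp L M (B \<union> D) y b\<^sub>4"
    by (rule tp_cong) (simp add: b4y b\<^sub>2_def g(3))
  then have nf_y4: "\<not> forks L M A y (tp L M (B \<union> D) y b\<^sub>4)" using b\<^sub>1(2) by simp
  have "tp L M (B \<union> b\<^sub>4 ` y \<union> D) x b\<^sub>3 = tp L M (B \<union> b\<^sub>4 ` y \<union> D) x b\<^sub>4"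
    by (rule tp_cong) (simp add: b\<^sub>4_def h(3))
  then have nf_x4: "\<not> forks L M (A \<union> b\<^sub>4 ` y) x (tp L M (B \<union> b\<^sub>4 ` y \<union> D) x b\<^sub>4)"
    using b\<^sub>3(2) by (simp add: b4y')
  have hA: "h ` A = A" using h(2) AB by force
  have alg4: "b\<^sub>4 ` z \<subseteq> acl L M (A \<union> b\<^sub>4 ` y \<union> b\<^sub>4 ` x)"
  proof -
    have "g (b v) \<in> acl L M (g ` (A \<union> b ` y \<union> b ` x))" if "v \<in> z" for v
      using alg that by (intro acl_automorphism[OF g(1)]) auto
    then have "b\<^sub>4 v \<in> acl L M (h ` g ` (A \<union> b ` y \<union> b ` x))" if "v \<in> z" for v
      using that acl_automorphism[OF h(1)] by (simp add: b\<^sub>4_def b\<^sub>2_def)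
    moreover have "h ` g ` (A \<union> b ` y \<union> b ` x) = A \<union> b\<^sub>4 ` y \<union> b\<^sub>4 ` x"
      by (simp add: image_Un gA hA b\<^sub>4_def b\<^sub>2_def image_comp comp_assoc)
    ultimately show ?thesis by auto
  qed
  \<comment> \<open>Both automorphisms fix \<open>B\<close>, so the moved tuple still satisfies the
    formulas that imply the disjunction.\<close>
  have "tp L M B z b\<^sub>4 = tp L M B z b"
    using tp_automorphism[OF h(1), of B z b\<^sub>2] tp_automorphism[OF g(1), of B z b] h(2) g(2)
    by (simp add: b\<^sub>4_def b\<^sub>2_def)
  then have "\<forall>\<gamma>\<in>\<Gamma>\<^sub>0. holds M b\<^sub>4 \<gamma>" using \<Gamma>\<^sub>0 by (auto simp: tp_def)
  then obtain \<psi> where \<psi>: "\<psi> \<in> \<Psi>" "holds M b\<^sub>4 \<psi>" using imp by blast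
  then have \<phi>: "\<phi> \<psi> \<in> fmls L z {..<n \<psi>}" "\<psi> = inst (d \<psi>) (\<phi> \<psi>)"
    "divides_inst L M A (n \<psi>) (d \<psi>) (\<phi> \<psi>)" using pres by auto
  have dD: "d \<psi> ` {..<n \<psi>} \<subseteq> D" using \<psi>(1) by (auto simp: D_def)
  have Ay: "small \<kappa> (A \<union> b\<^sub>4 ` y)" by (intro small_Un small_image A y)
  have "divides_inst L M (A \<union> b\<^sub>4 ` y) (n \<psi>) (d \<psi>) (\<phi> \<psi>)"
    using dD AB by (intro divides_inst_extend_base[OF A y \<phi>(1,3) _ _ nf_y4]) auto
  then have "divides_inst L M (A \<union> b\<^sub>4 ` y \<union> b\<^sub>4 ` x) (n \<psi>) (d \<psi>) (\<phi> \<psi>)"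
    using dD AB by (intro divides_inst_extend_base[OF Ay x \<phi>(1) _ _ _ nf_x4]) auto
  moreover have "small \<kappa> (A \<union> b\<^sub>4 ` y \<union> b\<^sub>4 ` x)" by (intro small_Un small_image Ay x)
  ultimately have "\<not> holds M b\<^sub>4 (inst (d \<psi>) (\<phi> \<psi>))"
    using algebraic_not_divides_inst \<phi>(1) alg4 by blast
  then show False using \<psi>(2) \<phi>(2) by simp
qed

text \<open>In the application \<open>z\<close> is \<open>x w\<close>, \<open>x\<close> is one of
  the \<open>x {i}\<close> and \<open>y\<close> is the union of the others. Uniqueness is put in
  terms of realizations \<open>e\<close>, the form in which the competing extension is
  constructed.\<close>

lemma unique_nonforking_extension_independent:
  fixes b :: "'v \<Rightarrow> 'm"
  assumes AB: "A \<subseteq> B" and B: "small \<kappa> B" and z: "small \<kappa> z" and xz: "x \<subseteq> z" and yz: "y \<subseteq> z"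
    and nf: "\<not> forks L M A z (tp L M B z b)"
    and unique: "\<And>e. tp L M A z e = tp L M A z b \<Longrightarrow> \<not> forks L M A z (tp L M B z e) \<Longrightarrow>
      tp L M B z e = tp L M B z b"
    and indep: "\<not> forks L M A x (tp L M (A \<union> b ` y) x b)"
    and alg: "b ` z \<subseteq> acl L M (A \<union> b ` y \<union> b ` x)"
  shows "\<not> forks L M B x (tp L M (B \<union> b ` y) x b)"
proof -
  have x: "small \<kappa> x" and y: "small \<kappa> y" using small_subset[OF z] xz yz by auto
  have Ay: "small \<kappa> (A \<union> b ` y)" by (intro small_Un small_image y small_subset[OF B AB])
  obtain b' where b': "tp L M (A \<union> b ` y) x b' = tp L M (A \<union> b ` y) x b"
    "\<not> forks L M A x (tp L M (A \<union> b ` y \<union> B) x b')"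
    using nonforking_realization[OF Ay B x indep] by blast
  obtain h where h: "automorphism L M h" "\<And>m. m \<in> A \<union> b ` y \<Longrightarrow> h m = m"
    "\<And>v. v \<in> x \<Longrightarrow> h (b v) = b' v"
    using same_type_automorphism[OF Ay x b'(1)[symmetric]] by auto
  \<comment> \<open>\<open>e\<close> agrees with \<open>b\<close> on \<open>y\<close> and with
    \<open>b'\<close> on \<open>x\<close>; as an image of \<open>b\<close> under an automorphism
    over \<open>A\<close> it keeps the type over \<open>A\<close>.\<close>
  define e where "e = h \<circ> b"
  have ey: "e v = b v" if "v \<in> y" for v using that h(2) by (simp add: e_def)
  then have ey': "e ` y = b ` y" by simp
  have "tp L M (B \<union> e ` y) x b' = tp L M (B \<union> e ` y) x e"
    by (rule tp_cong) (simp add: e_def h(3))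
  moreover have "A \<union> b ` y \<union> B = B \<union> e ` y" using AB ey' by auto
  ultimately have nf_x: "\<not> forks L M A x (tp L M (B \<union> e ` y) x e)" using b'(2) by simp
  \<comment> \<open>The part in \<open>y\<close> comes first: it is unchanged from \<open>b\<close>,
    so it inherits nonforking over \<open>A\<close> from the whole tuple. The part in
    \<open>x\<close> then does not fork over the base enlarged by it.\<close>
  have "\<not> forks L M A z (tp L M B z e)"
  proof (rule nonforking_left_transitive[OF AB B x y])
    have "tp L M B y e = tp L M B y b" by (rule tp_cong) (rule ey)
    then show "\<not> forks L M A y (tp L M B y e)"
      using nf forks_mono[OF _ subset_refl yz tp_mono[OF subset_refl yz]] by metis
    show "\<not> forks L M (A \<union> e ` y) x (tp L M (B \<union> e ` y) x e)"
      using nf_x forks_mono[of L M "A \<union> e ` y" x _ A x] by blast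
    have "h (b v) \<in> acl L M (h ` (A \<union> b ` y \<union> b ` x))" if "v \<in> z" for v
      using alg that by (intro acl_automorphism[OF h(1)]) auto
    moreover have "h ` A = A" using h(2) by force
    then have "h ` (A \<union> b ` y \<union> b ` x) = A \<union> e ` y \<union> e ` x"
      by (simp add: image_Un e_def image_comp)
    ultimately show "e ` z \<subseteq> acl L M (A \<union> e ` y \<union> e ` x)" by (auto simp: e_def)
  qed
  moreover have "tp L M A z e = tp L M A z b"
    unfolding e_def using h by (intro tp_automorphism) auto
  ultimately have "tp L M B z e = tp L M B z b" using unique by blast
  \<comment> \<open>Uniqueness has made \<open>e\<close> and \<open>b\<close> conjugate over
    \<open>B\<close>, so the nonforking built into \<open>e\<close> transfers to
    \<open>b\<close>.\<close>
  then obtain f where f: "automorphism L M f" "\<And>m. m \<in> B \<Longrightarrow> f m = m"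
    "\<And>v. v \<in> z \<Longrightarrow> f (e v) = b v"
    using same_type_automorphism[OF B z, of e b] by auto
  have "f ` A = A" "f ` B = B" using f(2) AB by force+
  moreover have "f ` e ` y = b ` y" using f(3) yz by (force simp: image_image)
  ultimately have "\<not> forks L M A x (tp L M (B \<union> b ` y) x (f \<circ> e))"
    using nf_x forks_automorphism[OF f(1), of A x "B \<union> e ` y" e] by (simp add: image_Un)
  moreover have "tp L M (B \<union> b ` y) x (f \<circ> e) = tp L M (B \<union> b ` y) x b"
    using f(3) xz by (intro tp_cong) auto
  ultimately show ?thesis using forks_mono[OF _ AB subset_refl subset_refl] by metis
qed

end

section \<open>Transfer of the clauses of an amalgamation system to the larger base\<close>

theorem lemma2p8:
  fixes L :: "('f, 'r) lang" and T :: "('f, 'r, nat) fm set"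
    and \<kappa> :: "'k rel" and M :: "('f, 'r, 'm) struct"
    and A B :: "'m set" and W :: "nat set set" and x :: "nat set \<Rightarrow> 'v set"
    and p q :: "nat set \<Rightarrow> ('f, 'r, 'v + 'm) fm set"
  assumes "complete_theory L T" and "monster_model L T \<kappa> M" and "simple_theory L M"
    and "A \<subseteq> B" and "small \<kappa> B" and "\<forall>w\<in>W. small \<kappa> (x w)"
    and "amalgamation_system L M A W x p"
    and "\<forall>w\<in>W. nonforking_extension L M A B (x w) (p w) (q w) \<and>
           (\<forall>q'. nonforking_extension L M A B (x w) (p w) q' \<longrightarrow> q' = q w)"
  shows "amalgamation_system L M B W x q"
proof -
  interpret monster L T \<kappa> M using assms(2) by unfold_locales
  have W: "finite W" "\<forall>w\<in>W. \<forall>v\<subseteq>w. v \<in> W"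
    and p: "\<forall>w\<in>W. complete_type L M A (x w) (p w)"
    and distinct: "\<forall>w\<in>W. \<forall>y\<in>x w. \<forall>z\<in>x w. y \<noteq> z \<longrightarrow>
        proves_disj M (p w) {Neg (Eq (At (Inl y)) (At (Inl z)))}"
    and inter: "\<forall>v\<in>W. \<forall>w\<in>W. x v \<inter> x w = x (v \<inter> w)"
    and restr: "\<forall>v\<in>W. \<forall>w\<in>W. v \<subseteq> w \<longrightarrow> p w \<inter> fmls L (x v) A = p v"
    and indep: "\<forall>w\<in>W. \<forall>b. realizes M b (p w) \<longrightarrow>
        independent L M A w (\<lambda>i. x {i}) b \<and> b ` x w \<subseteq> acl L M (A \<union> (\<Union>i\<in>w. b ` x {i}))"
    using assms(7) unfolding amalgamation_system_def by - (elim conjE, assumption)+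
  have q: "complete_type L M B (x w) (q w)" "p w \<subseteq> q w" "\<not> forks L M A (x w) (q w)"
    if "w \<in> W" for w
    using assms(8) that unfolding nonforking_extension_def by auto
  have unique: "q' = q w" if "w \<in> W" "nonforking_extension L M A B (x w) (p w) q'" for w q'
    using assms(8) that by blast
  have x_mono: "x v \<subseteq> x w" if "w \<in> W" "v \<subseteq> w" for v w
  proof -
    have "v \<in> W" using W(2) that by blast
    then have "x v \<inter> x w = x (v \<inter> w)" using inter that(1) by blast
    then show ?thesis using that(2) by (simp add: Int_absorb2) blast
  qed
  \<comment> \<open>The restriction of \<open>q w\<close> to the variables in \<open>x v\<close> is
    itself a nonforking extension of \<open>p v\<close>, so uniqueness identifies it with
    \<open>q v\<close>.\<close>
  have "q w \<inter> fmls L (x v) B = q v" if "w \<in> W" "v \<in> W" "v \<subseteq> w" for v w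
  proof (rule unique[OF that(2)])
    have xvw: "x v \<subseteq> x w" using x_mono that by blast
    have "complete_type L M B (x v) (q w \<inter> fmls L (x v) B)"
      using q(1)[OF that(1)] consistent_mono[of M "q w" "q w \<inter> fmls L (x v) B"]
        fmls_mono[OF xvw subset_refl[of B], of L]
      unfolding complete_type_def by auto
    moreover have "p v \<subseteq> q w \<inter> fmls L (x v) B"
      using restr that q(2)[OF that(1)] fmls_mono[OF subset_refl[of "x v"] assms(4), of L] by blast
    moreover have "\<not> forks L M A (x v) (q w \<inter> fmls L (x v) B)"
      using q(3)[OF that(1)] forks_mono[OF _ subset_refl xvw Int_lower1] by blast
    ultimately show "nonforking_extension L M A B (x v) (p v) (q w \<inter> fmls L (x v) B)"
      by (simp add: nonforking_extension_def)
  qed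
  moreover have "independent L M B w (\<lambda>i. x {i}) b \<and> b ` x w \<subseteq> acl L M (B \<union> (\<Union>i\<in>w. b ` x {i}))"
    if w: "w \<in> W" and b: "realizes M b (q w)" for w b
  proof
    have bp: "realizes M b (p w)" using b q(2)[OF w] by (auto simp: realizes_def)
    have qw: "q w = tp L M B (x w) b" using complete_type_realized[OF q(1)[OF w] b] .
    have pw: "p w = tp L M A (x w) b" using complete_type_realized bp p w by blast
    have alg: "b ` x w \<subseteq> acl L M (A \<union> (\<Union>i\<in>w. b ` x {i}))" using indep w bp by blast
    then show "b ` x w \<subseteq> acl L M (B \<union> (\<Union>i\<in>w. b ` x {i}))"
      using acl_mono[of "A \<union> (\<Union>i\<in>w. b ` x {i})" "B \<union> (\<Union>i\<in>w. b ` x {i})" L M] assms(4) by blast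
    show "independent L M B w (\<lambda>i. x {i}) b" unfolding independent_def
    proof
      fix i assume i: "i \<in> w"
      define y where "y = (\<Union>j\<in>w - {i}. x {j})"
      have by_eq: "(\<Union>j\<in>w - {i}. b ` x {j}) = b ` y" by (auto simp: y_def)
      have "\<not> forks L M B (x {i}) (tp L M (B \<union> b ` y) (x {i}) b)"
      proof (rule unique_nonforking_extension_independent[OF assms(4,5)])
        show "small \<kappa> (x w)" using assms(6) w by blast
        show "x {i} \<subseteq> x w" using x_mono w i by simp
        have "x {j} \<subseteq> x w" if "j \<in> w" for j using x_mono[OF w, of "{j}"] that by simp
        then show "y \<subseteq> x w" unfolding y_def by blast
        show "\<not> forks L M A (x w) (tp L M B (x w) b)" using q(3)[OF w] qw by simp
        show "\<not> forks L M A (x {i}) (tp L M (A \<union> b ` y) (x {i}) b)"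
          using indep w bp i unfolding independent_def by_eq[symmetric] by blast
        have "(\<Union>j\<in>w. b ` x {j}) = b ` y \<union> b ` x {i}" using i by (auto simp: y_def)
        then show "b ` x w \<subseteq> acl L M (A \<union> b ` y \<union> b ` x {i})" using alg by (simp add: Un_assoc)
        \<comment> \<open>The type of \<open>e\<close> over \<open>B\<close> extends
          \<open>p w\<close> without forking over \<open>A\<close>; hence it is \<open>q w\<close>,
          which is the type of \<open>b\<close>.\<close>
        fix e assume e: "tp L M A (x w) e = tp L M A (x w) b" "\<not> forks L M A (x w) (tp L M B (x w) e)"
        have "p w \<subseteq> tp L M B (x w) e"
          using tp_mono[OF assms(4) subset_refl, of L M "x w" e] e(1) pw by simp
        then have "tp L M B (x w) e = q w"
          using e(2) by (intro unique[OF w]) (simp add: nonforking_extension_def complete_type_tp)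
        then show "tp L M B (x w) e = tp L M B (x w) b" using qw by simp
      qed
      then show "\<not> forks L M B (x {i}) (tp L M (B \<union> (\<Union>j\<in>w - {i}. b ` x {j})) (x {i}) b)"
        by (simp add: by_eq)
    qed
  qed
  moreover have "proves_disj M (q w) {Neg (Eq (At (Inl y)) (At (Inl z)))}"
    if "w \<in> W" "y \<in> x w" "z \<in> x w" "y \<noteq> z" for w y z
    using distinct q(2)[of w] that unfolding proves_disj_def by (meson subset_trans)
  ultimately show ?thesis
    using W q(1) inter unfolding amalgamation_system_def by simp
qed

end
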